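(* Let $\mu=\max_{0\le\theta\le\pi/4}\dfrac{(\pi/2)-2\theta+\sin 2\theta}{\cos\theta}$ (so $\mu\approx1.61589$). There exists a function $g$ with $g(r)/r\to0$ as $r\to\infty$ such that for every positive integer $r$ there exists a $\mathrm{DD}(m,r)$ with $m\ge(\mu/2)r-g(r)$ (so $m\approx 0.80795\,r$).
   Context: The square grid is $\mathbb{Z}^2\subset\mathbb{R}^2$. A $\mathrm{DD}(m,r)$ is a set of $m$ points ("dots") of $\mathbb{Z}^2$ such that any two dots are at Euclidean distance at most $r$, and the vectors $a-b$, over ordered pairs $(a,b)$ of distinct dots, are pairwise distinct (i.e. the lines joining pairs of dots differ in length or slope). *)

theory Defs
  imports "HOL-Analysis.Analysis"
begin

text \<open>
  The plane is \<^typ>\<open>real \<times> real\<close>, whose library metric is Euclidean, and the square grid is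
  its subset \<open>\<int> \<times> \<int>\<close>.
\<close>

definition is_DD :: "nat \<Rightarrow> real \<Rightarrow> (real \<times> real) set \<Rightarrow> bool" where
  "is_DD m r D \<longleftrightarrow>
     D \<subseteq> \<int> \<times> \<int> \<and> finite D \<and> card D = m \<and>
     (\<forall>a\<in>D. \<forall>b\<in>D. dist a b \<le> r) \<and>
     inj_on (\<lambda>(a, b). a - b) {(a, b). a \<in> D \<and> b \<in> D \<and> a \<noteq> b}"

definition mu_fun :: "real \<Rightarrow> real" where
  "mu_fun \<theta> = (pi / 2 - 2 * \<theta> + sin (2 * \<theta>)) / cos \<theta>"

text \<open>
  \<^const>\<open>Max\<close> is meaningful only for finite sets, so the maximum over the interval is rendered
  by \<^const>\<open>Greatest\<close>; the lemmas below confirm that it is attained.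
\<close>

definition mu :: real where
  "mu = (GREATEST y. y \<in> mu_fun ` {0..pi / 4})"

lemma mu_fun_max_exists:
  "\<exists>\<theta>\<in>{0..pi / 4}. \<forall>\<phi>\<in>{0..pi / 4}. mu_fun \<phi> \<le> mu_fun \<theta>"
proof (rule continuous_attains_sup)
  have "cos \<theta> \<noteq> 0" if "\<theta> \<in> {0..pi / 4}" for \<theta> :: real
  proof -
    have "- (pi / 2) < \<theta>" "\<theta> < pi / 2"
      using that pi_gt_zero unfolding atLeastAtMost_iff by linarith+
    then show ?thesis
      using cos_gt_zero_pi by fastforce
  qed
  then show "continuous_on {0..pi / 4} mu_fun"
    unfolding mu_fun_def by (intro continuous_intros) auto
qed auto

lemma mu_attained: "mu \<in> mu_fun ` {0..pi / 4}"
  and mu_upper: "\<theta> \<in> {0..pi / 4} \<Longrightarrow> mu_fun \<theta> \<le> mu"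
proof -
  obtain t where t: "t \<in> {0..pi / 4}" "\<forall>\<phi>\<in>{0..pi / 4}. mu_fun \<phi> \<le> mu_fun t"
    using mu_fun_max_exists by blast
  have "mu = mu_fun t"
    unfolding mu_def by (rule Greatest_equality) (use t in auto)
  with t show "mu \<in> mu_fun ` {0..pi / 4}"
    and "\<theta> \<in> {0..pi / 4} \<Longrightarrow> mu_fun \<theta> \<le> mu"
    by auto
qed

end

theory Submission
  imports Defs "HOL-Number_Theory.Residue_Primitive_Roots" "HOL-Number_Theory.Prime_Powers"
    "HOL-Real_Asymp.Real_Asymp"
begin

text \<open>
  Let \<open>p\<close> be a prime and let \<open>g\<close> be a primitive root. Ruzsa's set \<open>{z. z \<equiv> g\<^sup>z mod p}\<close> is
  periodic modulo \<open>N = p (p - 1)\<close>, has density \<open>1 / p\<close>, and is a Sidon set modulo \<open>N\<close>. Pulled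
  back along \<open>(x, y) \<mapsto> x + a y\<close> and intersected with a finite set \<open>S\<close> of grid points on which
  this map is injective modulo \<open>N\<close>, each of its translates is a set with distinct differences,
  and by averaging some translate has at least \<open>card S / p\<close> points in \<open>S\<close>.

  Taking for \<open>S\<close> the part of a square inside a disc of radius \<open>R = r / 2\<close> gives exactly \<open>\<mu>\<close>, but
  only for one optimal ratio \<open>p / R\<close>, so that primes in intervals \<open>[x, (1 + o(1)) x]\<close> would be
  needed. Instead \<open>a\<close> is chosen such that the lattice \<open>x + a y \<equiv> 0 mod N\<close> is nearly hexagonal,
  and \<open>S\<close> is its Voronoi cell intersected with the disc. A hexagon beats the square by so much
  that \<open>card S \<ge> 1.62 p R\<close> holds for all ratios \<open>p / R\<close> between \<open>1.65\<close> and \<open>1.934\<close>, while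
  \<open>\<mu> < 1.62\<close>. The quotient of the two ends exceeds \<open>1.17\<close>, and Chebyshev's method provides a prime
  between \<open>x\<close> and \<open>l x\<close> for all large \<open>x\<close> as soon as \<open>l > 90 / 77 = 1.1688...\<close>. Hence the
  error term can even be chosen to vanish for large \<open>r\<close>.
\<close>

section \<open>Primes in short intervals\<close>

lemma ln_fact_eq_sum_mangoldt:
  "ln (fact n :: real) = (\<Sum>m=1..n. mangoldt m * real (n div m))"
proof (induction n)
  case (Suc n)
  have div_Suc': "real (Suc n div m) = real (n div m) + (if m dvd Suc n then 1 else 0)" for m
    by (auto simp: div_Suc dvd_eq_mod_eq_0 mod_Suc)
  have "(\<Sum>m=1..Suc n. mangoldt m * real (Suc n div m)) =
        (\<Sum>m=1..Suc n. mangoldt m * real (n div m)) +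
        (\<Sum>m=1..Suc n. if m dvd Suc n then mangoldt m else 0)"
    unfolding div_Suc' sum.distrib [symmetric] by (intro sum.cong) (auto simp: algebra_simps)
  also have "(\<Sum>m=1..Suc n. if m dvd Suc n then mangoldt m else 0) =
             (\<Sum>m | m dvd Suc n. mangoldt m :: real)"
    by (intro sum.mono_neutral_cong_right)
       (auto simp: Suc_le_eq intro: dvd_imp_le dvd_pos_nat[OF zero_less_Suc])
  also have "\<dots> = ln (real (Suc n))"
    by (subst mangoldt_sum) auto
  also have "(\<Sum>m=1..Suc n. mangoldt m * real (n div m)) = ln (fact n)"
    by (simp add: Suc)
  finally show ?case
    by (simp add: ln_mult add_ac del: of_nat_Suc)
qed auto

lemma ln_fact_bounds:
  assumes "n > 0"
  shows "ln (fact n) \<ge> real n * ln n - n"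
    and "ln (fact n) \<le> real n * ln n - n + ln n + 1"
proof -
  have step: "1 / (real n + 1) \<le> ln (real n + 1) - ln n" "ln (real n + 1) - ln n \<le> 1 / n"
    if "n > 0" for n :: nat
  proof -
    have "ln (real n / (n + 1)) \<le> real n / (n + 1) - 1"
      by (rule ln_le_minus_one) (use that in auto)
    thus "1 / (real n + 1) \<le> ln (real n + 1) - ln n"
      using that by (simp add: ln_div field_simps)
    have "ln ((real n + 1) / n) \<le> (real n + 1) / n - 1"
      by (rule ln_le_minus_one) (use that in auto)
    thus "ln (real n + 1) - ln n \<le> 1 / n"
      using that by (simp add: ln_div field_simps)
  qed
  show "ln (fact n) \<ge> real n * ln n - n"
    using assms
  proof (induction n rule: nat_induct_non_zero)
    case (Suc n)
    have "real n * (ln (real n + 1) - ln n) \<le> 1"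
      using step(2)[of n] Suc.hyps by (simp add: field_simps)
    moreover have "ln (fact (Suc n)) = ln (real n + 1) + ln (fact n :: real)"
      by (simp add: ln_mult add_ac del: of_nat_Suc)
    ultimately show ?case using Suc
      by (simp add: algebra_simps)
  qed auto
  show "ln (fact n) \<le> real n * ln n - n + ln n + 1"
    using assms
  proof (induction n rule: nat_induct_non_zero)
    case (Suc n)
    have "(real n + 1) * (ln (real n + 1) - ln n) \<ge> 1"
      using step(1)[of n] Suc.hyps by (simp add: field_simps)
    moreover have "ln (fact (Suc n)) = ln (real n + 1) + ln (fact n :: real)"
      by (simp add: ln_mult add_ac del: of_nat_Suc)
    ultimately show ?case using Suc
      by (simp add: algebra_simps)
  qed auto
qed

lemma ln_le_sqrt:
  assumes "(x :: real) > 0"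
  shows "ln x \<le> 2 * (sqrt x - 1)"
proof -
  have "ln x = 2 * ln (sqrt x)"
    using assms by (simp add: ln_sqrt)
  also have "\<dots> \<le> 2 * (sqrt x - 1)"
    using assms by (intro mult_left_mono ln_le_minus_one) auto
  finally show ?thesis .
qed

lemma x_ln_x_minus_x_mono:
  assumes "1 \<le> x" "x \<le> (y :: real)"
  shows "x * ln x - x \<le> y * ln y - y"
proof -
  have "ln (y / x) \<ge> 1 - x / y"
    using ln_le_minus_one[of "x / y"] assms by (simp add: ln_div)
  hence "y * (ln y - ln x) \<ge> y * (1 - x / y)"
    using assms by (intro mult_left_mono) (auto simp: ln_div)
  moreover have "(y - x) * ln x \<ge> 0" using assms by auto
  ultimately show ?thesis
    using assms by (simp add: algebra_simps)
qed

lemma of_nat_div_le_Suc_div: "real n / real d \<le> real (n div d) + 1"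
proof (cases "d = 0")
  case False
  have "n = d * (n div d) + n mod d" by simp
  moreover have "n mod d < d" using False by simp
  ultimately have "n \<le> d * (n div d + 1)" by (metis add_le_cancel_left distrib_left less_imp_le mult.right_neutral)
  hence "real n \<le> real d * (real (n div d) + 1)" by (metis of_nat_1 of_nat_add of_nat_le_iff of_nat_mult)
  thus ?thesis using False by (simp add: field_simps)
qed auto

text \<open>With \<open>k = n div d\<close> one has \<open>k \<le> y \<le> k + 1\<close>, and x ln x
  - x increases for x \<ge> 1, so dropping the floor costs at most \<open>ln y + 1\<close>. The
  coarser \<open>2 * sqrt n\<close> has a shape that the induction for \<open>psi\<close> can
  carry.\<close>

lemma ln_fact_div_approx:
  fixes n d :: nat
  assumes "d > 0" "d \<le> n"
  defines "y \<equiv> real n / real d"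
  shows "\<bar>ln (fact (n div d)) - (y * ln y - y)\<bar> \<le> 2 * sqrt n"
proof -
  define k where "k = n div d"
  have "k > 0" using assms by (auto simp: k_def div_greater_zero_iff)
  have ky: "real k \<le> y" unfolding k_def y_def by (rule of_nat_div_le_of_nat)
  have yk: "y \<le> real k + 1"
    unfolding k_def y_def by (rule of_nat_div_le_Suc_div) 
  have y1: "y \<ge> 1" using \<open>k > 0\<close> ky by linarith
  have "y \<le> n"
    unfolding y_def using assms by (simp add: field_simps)
  hence "sqrt y \<le> sqrt n" by (rule real_sqrt_le_mono)
  hence err: "ln y + 1 \<le> 2 * sqrt n"
    using ln_le_sqrt[OF less_le_trans[OF zero_less_one y1]] by argo
  have "ln (fact k) \<le> real k * ln k - k + ln k + 1"
    using \<open>k > 0\<close> by (rule ln_fact_bounds)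
  also have "real k * ln k - k \<le> y * ln y - y"
    using \<open>k > 0\<close> ky by (intro x_ln_x_minus_x_mono) auto
  also have "ln k \<le> ln y" using \<open>k > 0\<close> ky by simp
  finally have up: "ln (fact k) \<le> y * ln y - y + (ln y + 1)" by simp
  have "y * ln y - y \<le> (real k + 1) * ln (real k + 1) - (real k + 1)"
    using y1 yk by (intro x_ln_x_minus_x_mono) auto
  also have "\<dots> \<le> ln (fact (Suc k))"
    using ln_fact_bounds(1)[of "Suc k"] by (simp add: add_ac)
  also have "\<dots> = ln (fact k) + ln (real k + 1)"
    by (simp add: ln_mult add_ac)
  also have "ln (real k + 1) \<le> ln (2 * y)"
    using \<open>k > 0\<close> ky by simp
  also have "\<dots> = ln y + ln 2" using y1 by (simp add: ln_mult)
  also have "ln 2 \<le> (1 :: real)" using ln_le_minus_one[of "2::real"] by simp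
  finally have "y * ln y - y \<le> ln (fact k) + (ln y + 1)" by simp
  with up err show ?thesis unfolding k_def by linarith
qed

section \<open>Chebyshev's bounds for \<open>psi\<close>\<close>

definition psi :: "nat \<Rightarrow> real" where
  "psi n = (\<Sum>m=1..n. mangoldt m)"

lemma psi_mono: "m \<le> n \<Longrightarrow> psi m \<le> psi n"
  unfolding psi_def by (intro sum_mono2) (auto intro: mangoldt_nonneg)

text \<open>Chebyshev's combination: since 1 - 1/2 - 1/3 - 1/5 + 1/30 = 0, the n ln n and -n parts
  of Stirling's formula cancel. What remains are the terms n ln d / d, which add up to
  \<open>cheb_const * n\<close>, with constant 0.92129...\<close>

definition cheb :: "nat \<Rightarrow> real" where
  "cheb n = ln (fact n) - ln (fact (n div 2)) - ln (fact (n div 3)) - ln (fact (n div 5))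
            + ln (fact (n div 30))"

definition cheb_const :: real where
  "cheb_const = ln 2 / 2 + ln 3 / 3 + ln 5 / 5 - ln 30 / 30"

lemma cheb_const_pos: "cheb_const > 0"
proof -
  have "ln (30 :: real) = ln 2 + ln 3 + ln 5"
    using ln_mult[of 2 "3::real"] ln_mult[of 6 "5::real"] by simp
  moreover have "ln 2 > (0 :: real)" "ln 3 > (0 :: real)" "ln 5 > (0 :: real)" by auto
  ultimately show ?thesis unfolding cheb_const_def by linarith
qed

lemma cheb_approx:
  assumes "n \<ge> 30"
  shows "\<bar>cheb n - cheb_const * n\<bar> \<le> 10 * sqrt n"
proof -
  define f where "f d = real n / d * ln (real n / d) - real n / d" for d :: real
  have "f 1 - f 2 - f 3 - f 5 + f 30 = cheb_const * n"
    using assms by (simp add: f_def cheb_const_def ln_div field_simps)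
  moreover have "\<bar>ln (fact (n div d)) - f d\<bar> \<le> 2 * sqrt n" if "d > 0" "d \<le> 30" for d :: nat
    using ln_fact_div_approx[of d n] that assms by (simp add: f_def)
  note this[of 1] this[of 2] this[of 3] this[of 5] this[of 30]
  ultimately have "cheb n - cheb_const * n \<le> 10 * sqrt n" "cheb_const * n - cheb n \<le> 10 * sqrt n"
    unfolding cheb_def abs_le_iff by simp_all
  thus ?thesis by (simp add: abs_le_iff)
qed

text \<open>The coefficient of \<open>mangoldt m\<close> in \<open>cheb n\<close>, taken at
  \<open>y = n div m\<close>.\<close>

definition cheb_weight :: "nat \<Rightarrow> int" where
  "cheb_weight y = int y - int (y div 2) - int (y div 3) - int (y div 5) + int (y div 30)"

lemma cheb_weight_mod: "cheb_weight y = cheb_weight (y mod 30)"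
proof -
  define z w where "z = y div 30" and "w = y mod 30"
  have y: "y = w + 30 * z" by (simp add: z_def w_def)
  have "y div 2 = w div 2 + 15 * z" "y div 3 = w div 3 + 10 * z" "y div 5 = w div 5 + 6 * z"
    "y div 30 = w div 30 + z"
    unfolding y by (simp_all add: div_add1_eq)
  thus ?thesis unfolding cheb_weight_def w_def[symmetric] by (simp add: y)
qed

text \<open>Periodicity modulo 30 leaves a finite check: all values are 0 or 1, and the value is 1
  on 1..5 and on 7..9. Keeping the second block as well lowers the ratio of the bounds for
  \<open>psi\<close> from Chebyshev's 6/5, too large for the later window of primes, to
  90/77.\<close>

lemma cheb_weight_bounds:
  "cheb_weight y \<le> (if y \<ge> 1 then 1 else 0)"
  "cheb_weight y \<ge> (if y \<ge> 1 then 1 else 0) - (if y \<ge> 6 then 1 else 0)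
                   + (if y \<ge> 7 then 1 else 0) - (if y \<ge> 10 then 1 else 0)"
proof -
  have *: "\<forall>w\<in>set [0..<30]. cheb_weight w \<in> {0, 1} \<and>
        (w \<noteq> 0 \<and> w < 6 \<or> 7 \<le> w \<and> w < 10 \<longrightarrow> cheb_weight w = 1)"
    unfolding cheb_weight_def by code_simp
  have "y mod 30 \<in> set [0..<30]" by simp
  with * have 1: "cheb_weight y \<in> {0, 1}" using cheb_weight_mod[of y] by metis
  have 2: "cheb_weight y = 1" if "y \<noteq> 0 \<and> y < 6 \<or> 7 \<le> y \<and> y < 10"
    using * that by auto
  have 3: "cheb_weight y = 0" if "y = 0" using that by (simp add: cheb_weight_def)
  show "cheb_weight y \<le> (if y \<ge> 1 then 1 else 0)" using 1 3 by (cases "y = 0") auto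
  show "cheb_weight y \<ge> (if y \<ge> 1 then 1 else 0) - (if y \<ge> 6 then 1 else 0)
                   + (if y \<ge> 7 then 1 else 0) - (if y \<ge> 10 then 1 else 0)"
    using 1 2 3 by auto
qed

text \<open>The two divisions commute, and the terms with \<open>m > n div d\<close> vanish; thus
  all five factorials in \<open>cheb\<close> become sums over the same range.\<close>

lemma ln_fact_div_eq_sum_mangoldt:
  "ln (fact (n div d) :: real) = (\<Sum>m=1..n. mangoldt m * real (n div m div d))"
proof -
  have "n div m div d = 0" if "m \<in> {1..n} - {1..n div d}" for m
  proof (cases "d = 0")
    case False
    have "n div d < m" using that by auto
    thus ?thesis by (simp add: div_mult2_eq [symmetric] mult.commute[of m] del: div_mult2_eq)
                    (simp add: div_mult2_eq)
  qed auto
  hence "(\<Sum>m=1..n. mangoldt m * real (n div m div d)) =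
         (\<Sum>m=1..n div d. mangoldt m * real (n div m div d))"
    by (intro sum.mono_neutral_right) (auto intro: order_trans[OF _ div_le_dividend])
  also have "\<dots> = (\<Sum>m=1..n div d. mangoldt m * real (n div d div m))"
    by (simp only: div_mult2_eq [symmetric] mult.commute)
  finally show ?thesis by (simp add: ln_fact_eq_sum_mangoldt)
qed

lemma cheb_eq_sum: "cheb n = (\<Sum>m=1..n. mangoldt m * of_int (cheb_weight (n div m)))"
  unfolding cheb_def ln_fact_div_eq_sum_mangoldt ln_fact_eq_sum_mangoldt[of n] cheb_weight_def
  by (simp add: sum.distrib sum_subtractf algebra_simps)

lemma psi_div:
  assumes "d > 0"
  shows "psi (n div d) = (\<Sum>m=1..n. mangoldt m * (if n div m \<ge> d then 1 else 0))"
proof -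
  have "m \<le> n div d \<longleftrightarrow> d \<le> n div m" if "m > 0" for m
    using that assms by (simp add: less_eq_div_iff_mult_less_eq mult.commute)
  moreover have "n div d \<le> n" by simp
  ultimately show ?thesis unfolding psi_def
    by (intro sum.mono_neutral_cong_left) auto
qed

lemma cheb_le_psi: "cheb n \<le> psi n"
proof -
  have "cheb n \<le> (\<Sum>m=1..n. mangoldt m * (if n div m \<ge> 1 then 1 else 0))"
    unfolding cheb_eq_sum
  proof (intro sum_mono mult_left_mono mangoldt_nonneg)
    fix m show "real_of_int (cheb_weight (n div m)) \<le> (if 1 \<le> n div m then 1 else 0)"
      using cheb_weight_bounds(1)[of "n div m"] by (auto split: if_splits)
  qed
  also have "\<dots> = psi n" using psi_div[of 1 n] by simp
  finally show ?thesis .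
qed

lemma cheb_ge_psi:
  "cheb n \<ge> psi n - psi (n div 6) + psi (n div 7) - psi (n div 10)"
proof -
  define b :: "nat \<Rightarrow> nat \<Rightarrow> real" where "b d m = (if n div m \<ge> d then 1 else 0)" for d m
  have psi_b: "psi (n div d) = (\<Sum>m=1..n. mangoldt m * b d m)" if "d > 0" for d
    using psi_div[OF that, of n] by (simp add: b_def)
  have "psi n - psi (n div 6) + psi (n div 7) - psi (n div 10) =
        (\<Sum>m=1..n. mangoldt m * b 1 m) - (\<Sum>m=1..n. mangoldt m * b 6 m)
        + (\<Sum>m=1..n. mangoldt m * b 7 m) - (\<Sum>m=1..n. mangoldt m * b 10 m)"
    using psi_b[of 1] psi_b[of 6] psi_b[of 7] psi_b[of 10] by simp
  also have "\<dots> = (\<Sum>m=1..n. mangoldt m * (b 1 m - b 6 m + b 7 m - b 10 m))"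
    by (simp only: right_diff_distrib distrib_left sum_subtractf sum.distrib)
  also have "\<dots> \<le> cheb n"
    unfolding cheb_eq_sum
  proof (intro sum_mono mult_left_mono mangoldt_nonneg)
    fix m
    have "b 1 m - b 6 m + b 7 m - b 10 m = real_of_int ((if n div m \<ge> 1 then 1 else 0)
        - (if n div m \<ge> 6 then 1 else 0) + (if n div m \<ge> 7 then 1 else 0)
        - (if n div m \<ge> 10 then 1 else 0))"
      by (simp add: b_def)
    also have "\<dots> \<le> cheb_weight (n div m)"
      by (simp only: of_int_le_iff cheb_weight_bounds(2))
    finally show "b 1 m - b 6 m + b 7 m - b 10 m \<le> cheb_weight (n div m)" .
  qed
  finally show ?thesis .
qed

lemma psi_lower:
  obtains c where "c > 0" "\<And>n. n > 0 \<Longrightarrow> psi n \<ge> cheb_const * n - c * sqrt n"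
proof
  show "10 + 30 * cheb_const > 0" using cheb_const_pos by simp
  fix n :: nat assume "n > 0"
  show "psi n \<ge> cheb_const * n - (10 + 30 * cheb_const) * sqrt n"
  proof (cases "n \<ge> 30")
    case True
    have "30 * cheb_const * sqrt n \<ge> 0" using cheb_const_pos by simp
    thus ?thesis using cheb_approx[OF True] cheb_le_psi[of n] by (simp add: algebra_simps)
  next
    case False
    have "real n \<le> 30" "1 \<le> sqrt n" using False \<open>n > 0\<close> by auto
    hence "real n \<le> 30 * sqrt n" by linarith
    hence "cheb_const * n \<le> cheb_const * (30 * sqrt n)"
      using cheb_const_pos by (intro mult_left_mono) auto
    moreover have "psi n \<ge> 0" unfolding psi_def by (intro sum_nonneg mangoldt_nonneg)
    moreover have "(10 + 30 * cheb_const) * sqrt n = 10 * sqrt n + cheb_const * (30 * sqrt n)"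
      by (simp add: algebra_simps)
    ultimately show ?thesis using \<open>1 \<le> sqrt n\<close> by linarith
  qed
qed

text \<open>
  The constant \<open>B = 90 / 77\<close> solves \<open>B = 1 + B / 6 - 1 / 7 + B / 10\<close>, which comes from the
  recursive bound for \<open>psi n\<close> in \<open>cheb_ge_psi\<close>. The error term \<open>sqrt n\<close> survives the induction
  since \<open>sqrt (1 / 6) + sqrt (1 / 10) < 1\<close>.
\<close>

lemma psi_upper:
  obtains C where "C > 0" "\<And>n. n > 0 \<Longrightarrow> psi n \<le> 90 / 77 * cheb_const * n + C * sqrt n"
proof -
  define A where "A = cheb_const"
  have A: "A > 0" using cheb_const_pos by (simp add: A_def)
  obtain c where c: "c > 0" "\<And>n. n > 0 \<Longrightarrow> psi n \<ge> A * n - c * sqrt n"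
    using psi_lower unfolding A_def by blast
  \<comment> \<open>The factor 4 suffices because 1 - 41/100 - 32/100 = 27/100 exceeds 1/4;
    \<open>psi 30\<close> covers the range below 30.\<close>
  define C where "C = 4 * (10 + A + c) + psi 30"
  have "psi 30 \<ge> 0" unfolding psi_def by (intro sum_nonneg mangoldt_nonneg)
  hence C: "C > 0" "C \<ge> psi 30" "C \<ge> 4 * (10 + A + c)" using A c by (auto simp: C_def)
  have "psi n \<le> 90 / 77 * A * n + C * sqrt n" if "n > 0" for n
    using that
  proof (induction n rule: less_induct)
    case (less n)
    have s1: "sqrt n \<ge> 1" using less.prems by simp
    show ?case
    proof (cases "n \<ge> 30")
      case False
      hence "psi n \<le> C * 1" using psi_mono[of n 30] C by simp
      also have "C * 1 \<le> C * sqrt n" using s1 C by (intro mult_left_mono) auto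
      moreover have "A * real n \<ge> 0" using A by simp
      ultimately show ?thesis by simp
    next
      case True
      \<comment> \<open>\<open>s\<close> is a rational upper bound for 1 / sqrt d: 41/100 for d = 6
        and 32/100 for d = 10.\<close>
      have IH: "psi (n div d) \<le> 90 / 77 * A * (n / d) + C * (s * sqrt n)"
        if d: "1 < d" "d \<le> 30" and s: "s \<ge> 0" "1 / real d \<le> s ^ 2" for d s
      proof -
        have "psi (n div d) \<le> 90 / 77 * A * real (n div d) + C * sqrt (n div d)"
          using d True by (intro less.IH) (auto simp: div_greater_zero_iff)
        also have "\<dots> \<le> 90 / 77 * A * (n / d) + C * (s * sqrt n)"
          using A C of_nat_div_le_of_nat[of n d]
        proof (intro add_mono mult_left_mono)
          have "real (n div d) \<le> n / d" by (rule of_nat_div_le_of_nat)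
          also have "\<dots> \<le> s ^ 2 * n" using s(2) mult_right_mono[of "1 / d" "s ^ 2" n] by simp
          finally have "sqrt (n div d) \<le> sqrt (s ^ 2 * n)" by simp
          thus "sqrt (n div d) \<le> s * sqrt n" using s by (simp add: real_sqrt_mult)
        qed auto
        finally show ?thesis .
      qed
      have i6: "psi (n div 6) \<le> 90 / 77 * A * (n / 6) + C * (41 / 100 * sqrt n)"
        using IH[of 6 "41/100"] by (simp add: power2_eq_square)
      have i10: "psi (n div 10) \<le> 90 / 77 * A * (n / 10) + C * (32 / 100 * sqrt n)"
        using IH[of 10 "32/100"] by (simp add: power2_eq_square)
      have "real (n div 7) \<ge> n / 7 - 1" using of_nat_div_le_Suc_div[of n 7] by simp
      hence "A * real (n div 7) \<ge> A * (n / 7 - 1)" using A by (intro mult_left_mono) auto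
      moreover have "c * sqrt (n div 7) \<le> c * sqrt n"
        using c by (intro mult_left_mono) auto
      moreover have "psi (n div 7) \<ge> A * real (n div 7) - c * sqrt (n div 7)"
        using True by (intro c) auto
      ultimately have i7: "psi (n div 7) \<ge> A * (n / 7 - 1) - c * sqrt n" by linarith
      have "psi n \<le> cheb n + psi (n div 6) - psi (n div 7) + psi (n div 10)"
        using cheb_ge_psi[of n] by simp
      also have "cheb n \<le> A * n + 10 * sqrt n"
        using cheb_approx[OF True] by (simp add: A_def)
      finally have "psi n \<le> A * n + 10 * sqrt n + 90 / 77 * A * (n / 6) + C * (41 / 100 * sqrt n)
          - A * (n / 7 - 1) + c * sqrt n + 90 / 77 * A * (n / 10) + C * (32 / 100 * sqrt n)"
        using i6 i7 i10 by linarith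
      also have "\<dots> = 90 / 77 * A * n + (10 + c + 73 / 100 * C) * sqrt n + A * 1"
        by (simp add: field_simps)
      also have "A * 1 \<le> A * sqrt n" using A s1 by (intro mult_left_mono) auto
      also have "90 / 77 * A * n + (10 + c + 73 / 100 * C) * sqrt n + A * sqrt n =
                 90 / 77 * A * n + (10 + A + c + 73 / 100 * C) * sqrt n"
        by (simp add: algebra_simps)
      also have "(10 + A + c + 73 / 100 * C) * sqrt n \<le> C * sqrt n"
        using C A c by (intro mult_right_mono) auto
      finally show ?thesis by simp
    qed
  qed
  thus ?thesis using that[of C] C by (simp add: A_def)
qed

section \<open>From \<open>psi\<close> back to primes\<close>

text \<open>A prime power \<open>p ^ k \<le> n\<close> with \<open>k \<ge> 2\<close> has
  \<open>p \<le> sqrt n\<close> and \<open>k \<le> log 2 n\<close>, so there are few of them, each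
  contributing at most \<open>ln n\<close>.\<close>

lemma sum_mangoldt_nonprime_le:
  fixes n :: nat
  assumes "n > 0"
  shows "(\<Sum>m | m \<in> {1..n} \<and> \<not> prime m. mangoldt m) \<le> sqrt n * (log 2 n + 1) * ln n"
proof -
  define Q where "Q = {m \<in> {1..n}. primepow m \<and> \<not> prime m}"
  define P where "P = {1..nat \<lfloor>sqrt n\<rfloor>} \<times> {1..nat \<lfloor>log 2 n\<rfloor>}"
  have "Q \<subseteq> (\<lambda>(p, k). p ^ k) ` P"
  proof
    fix m assume m: "m \<in> Q"
    then obtain p k where pk: "prime p" "k > 0" "m = p ^ k"
      by (auto simp: Q_def primepow_def)
    have "k \<noteq> 1" using m pk by (auto simp: Q_def)
    hence "k \<ge> 2" using pk by linarith
    have p2: "p \<ge> 2" using pk prime_ge_2_nat by blast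
    have mn: "m \<le> n" using m by (auto simp: Q_def)
    have "p ^ 2 \<le> m" using \<open>k \<ge> 2\<close> p2 pk by (auto intro!: power_increasing)
    hence "real (p ^ 2) \<le> n" using mn by linarith
    hence "real p \<le> sqrt n" by (intro real_le_rsqrt) simp
    hence 1: "p \<le> nat \<lfloor>sqrt n\<rfloor>" by linarith
    have "2 ^ k \<le> m" using p2 pk by (auto intro!: power_mono)
    hence "2 powr k \<le> n" using mn by (simp add: powr_realpow)
    hence "real k \<le> log 2 n" using assms by (simp add: le_log_iff)
    hence 2: "k \<le> nat \<lfloor>log 2 n\<rfloor>" by linarith
    show "m \<in> (\<lambda>(p, k). p ^ k) ` P"
      using 1 2 pk p2 by (intro image_eqI[of _ _ "(p, k)"]) (simp_all add: P_def)
  qed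
  moreover have "finite P" by (simp add: P_def)
  ultimately have "card Q \<le> card P"
    by (meson card_image_le card_mono finite_imageI order_trans)
  also have "card P = nat \<lfloor>sqrt n\<rfloor> * nat \<lfloor>log 2 n\<rfloor>" by (simp add: P_def)
  finally have "real (card Q) \<le> real (nat \<lfloor>sqrt n\<rfloor>) * real (nat \<lfloor>log 2 n\<rfloor>)"
    by (metis of_nat_le_iff of_nat_mult)
  also have "\<dots> \<le> sqrt n * log 2 n"
    using assms by (intro mult_mono) auto
  finally have cQ: "real (card Q) \<le> sqrt n * (log 2 n + 1)"
    by (simp add: algebra_simps) (smt (verit) real_sqrt_ge_zero of_nat_0_le_iff)
  have "(\<Sum>m | m \<in> {1..n} \<and> \<not> prime m. mangoldt m) = (\<Sum>m\<in>Q. mangoldt m :: real)"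
    by (intro sum.mono_neutral_right) (auto simp: Q_def mangoldt_def)
  also have "\<dots> \<le> (\<Sum>m\<in>Q. ln n)"
  proof (intro sum_mono)
    fix m assume "m \<in> Q"
    hence "m > 0" "m \<le> n" by (auto simp: Q_def)
    thus "mangoldt m \<le> ln (real n)" using mangoldt_le[of m] by (smt (verit) ln_le_cancel_iff of_nat_0_less_iff of_nat_le_iff)
  qed
  also have "\<dots> = real (card Q) * ln n" by simp
  also have "\<dots> \<le> sqrt n * (log 2 n + 1) * ln n"
    using cQ assms by (intro mult_right_mono) auto
  finally show ?thesis .
qed

lemma psi_diff_le_if_no_primes:
  assumes "m \<le> n" "n > 0" "\<And>p. m < p \<Longrightarrow> p \<le> n \<Longrightarrow> \<not> prime p"
  shows "psi n - psi m \<le> sqrt n * (log 2 n + 1) * ln n"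
proof -
  have "psi n - psi m = (\<Sum>k\<in>{1..n} - {1..m}. mangoldt k)"
    unfolding psi_def using assms by (subst sum_diff) auto
  also have "\<dots> \<le> (\<Sum>k | k \<in> {1..n} \<and> \<not> prime k. mangoldt k)"
    by (intro sum_mono2) (use assms in \<open>auto intro: mangoldt_nonneg\<close>)
  also have "\<dots> \<le> sqrt n * (log 2 n + 1) * ln n"
    by (rule sum_mangoldt_nonprime_le[OF assms(2)])
  finally show ?thesis .
qed

text \<open>From x to l x, \<open>psi\<close> grows by at least A (l - 90/77) x - O(sqrt x). Without
  primes in between, only proper prime powers would contribute, which is O(sqrt x (ln x)^2) in
  all.\<close>

theorem eventually_prime_between:
  fixes l :: real
  assumes "l > 90 / 77"
  shows "eventually (\<lambda>x::real. \<exists>p. prime p \<and> x < real p \<and> real p \<le> l * x) at_top"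
proof -
  define A where "A = cheb_const"
  have A: "A > 0" using cheb_const_pos by (simp add: A_def)
  obtain c where c: "c > 0" "\<And>n. n > 0 \<Longrightarrow> psi n \<ge> A * n - c * sqrt n"
    using psi_lower unfolding A_def by blast
  obtain C where C: "C > 0" "\<And>n. n > 0 \<Longrightarrow> psi n \<le> 90 / 77 * A * n + C * sqrt n"
    using psi_upper unfolding A_def by blast
  define d where "d = A * (l - 90 / 77)"
  have d: "d > 0" using A assms by (simp add: d_def)
  \<comment> \<open>The left side collects the prime powers, the floor of \<open>l * x\<close>, and
    the two square-root errors of \<open>psi\<close>.\<close>
  have ev1: "eventually (\<lambda>x::real. sqrt (l * x) * (log 2 (l * x) + 1) * ln (l * x) + A + c * sqrt (l * x) + C * sqrt x < d * x) at_top"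
    using d assms c(1) C(1) unfolding log_def by real_asymp
  show ?thesis
    using ev1 eventually_ge_at_top[of 1]
  proof eventually_elim
    case (elim x)
    define m n where "m = nat \<lfloor>x\<rfloor>" and "n = nat \<lfloor>l * x\<rfloor>"
    have lx: "l * x \<ge> x" using assms elim by (simp add: mult_le_cancel_right1)
    have m: "m > 0" "real m \<le> x" "x < real m + 1" using elim by (auto simp: m_def)
    have lx1: "l * x \<ge> 1" using lx elim by linarith
    have n: "n > 0" "real n \<le> l * x" "l * x < real n + 1" using lx1 by (auto simp: n_def)
    have mn: "m \<le> n" unfolding m_def n_def using lx by (intro nat_mono floor_mono)
    have "\<exists>p. prime p \<and> m < p \<and> p \<le> n"
    proof (rule ccontr)
      assume "\<not> ?thesis"
      hence "psi n - psi m \<le> sqrt n * (log 2 n + 1) * ln n"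
        using mn n by (intro psi_diff_le_if_no_primes) auto
      also have "\<dots> \<le> sqrt (l * x) * (log 2 (l * x) + 1) * ln (l * x)"
        using n elim by (intro mult_mono mult_nonneg_nonneg add_right_mono) auto
      finally have 1: "psi n - psi m \<le> \<dots>" .
      have "psi n \<ge> A * n - c * sqrt n" using c n by auto
      moreover have "A * n \<ge> A * (l * x - 1)" using A n by (intro mult_left_mono) auto
      moreover have "c * sqrt n \<le> c * sqrt (l * x)" using c n by (intro mult_left_mono) auto
      moreover have "psi m \<le> 90 / 77 * A * m + C * sqrt m" using C m by auto
      moreover have "90 / 77 * A * m \<le> 90 / 77 * A * x" using A m by (intro mult_left_mono) auto
      moreover have "C * sqrt m \<le> C * sqrt x" using C m by (intro mult_left_mono) auto
      ultimately have "psi n - psi m \<ge> A * (l * x - 1) - c * sqrt (l * x) - (90 / 77 * A * x + C * sqrt x)"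
        by linarith
      also have "A * (l * x - 1) - c * sqrt (l * x) - (90 / 77 * A * x + C * sqrt x) =
                 d * x - (A + c * sqrt (l * x) + C * sqrt x)"
        by (simp add: d_def algebra_simps)
      finally show False using elim(1) 1 by linarith
    qed
    then obtain p where p: "prime p" "m < p" "p \<le> n" by blast
    have "x < real p" "real p \<le> l * x" using p m n by linarith+
    with p show ?case by blast
  qed
qed

section \<open>The numerical value of \<open>\<mu>\<close>\<close>

text \<open>With \<open>t\<close> a maximizer, the claim amounts to \<open>f t \<ge> 0\<close>. The
  sign of the derivative shows that \<open>f\<close> is least at \<open>t0\<close>, where sin equals
  81/200.\<close>

lemma mu_le: "mu \<le> 81 / 50"
proof -
  obtain t where t: "0 \<le> t" "t \<le> pi / 4" "mu = mu_fun t"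
    using mu_attained by auto
  define f where "f = (\<lambda>x :: real. 81 / 50 * cos x - pi / 2 + 2 * x - sin (2 * x))"
  define t0 where "t0 = arcsin (81 / 200)"
  have sin_t0: "sin t0 = 81 / 200" and t0_bounds: "0 \<le> t0" "t0 \<le> pi / 2"
    unfolding t0_def using arcsin_le_arcsin[of 0 "81/200"] arcsin_bounded[of "81/200"] by simp_all
  have deriv: "(f has_real_derivative (2 * sin x * (2 * sin x - 81 / 100))) (at x)" for x
  proof -
    have "(f has_real_derivative (81 / 50 * (- sin x) + 2 - 2 * cos (2 * x))) (at x)"
      unfolding f_def by (auto intro!: derivative_eq_intros)
    also have "81 / 50 * (- sin x) + 2 - 2 * cos (2 * x) = 2 * sin x * (2 * sin x - 81 / 100)"
      unfolding cos_double_sin by (simp add: power2_eq_square algebra_simps)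
    finally show ?thesis .
  qed
  have "f t0 \<le> f t"
  proof (cases "t \<le> t0")
    case True
    show ?thesis
    proof (rule DERIV_nonpos_imp_nonincreasing[OF True])
      fix x assume x: "t \<le> x" "x \<le> t0"
      have "sin x \<ge> 0" using x t t0_bounds by (intro sin_ge_zero) auto
      moreover have "sin x \<le> sin t0" using x t t0_bounds by (subst sin_mono_le_eq) auto
      ultimately have "2 * sin x * (2 * sin x - 81 / 100) \<le> 0"
        unfolding sin_t0 by (intro mult_nonneg_nonpos) auto
      thus "\<exists>y. (f has_real_derivative y) (at x) \<and> y \<le> 0" using deriv by blast
    qed
  next
    case False
    show ?thesis
    proof (rule DERIV_nonneg_imp_nondecreasing[of t0 t f])
      show "t0 \<le> t" using False by simp
      fix x assume x: "t0 \<le> x" "x \<le> t"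
      have "sin x \<ge> sin t0" using x t t0_bounds by (subst sin_mono_le_eq) auto
      hence "2 * sin x * (2 * sin x - 81 / 100) \<ge> 0"
        unfolding sin_t0 by (intro mult_nonneg_nonneg) auto
      thus "\<exists>y. (f has_real_derivative y) (at x) \<and> y \<ge> 0" using deriv by blast
    qed
  qed
  moreover have "f t0 \<ge> 0"
  proof -
    have cos_t0: "cos t0 \<ge> 914 / 1000"
    proof -
      have "cos t0 = sqrt (1 - (81 / 200)\<^sup>2)"
        unfolding t0_def by (rule cos_arcsin) auto
      also have "\<dots> \<ge> 914 / 1000" by (intro real_le_rsqrt) (simp add: power2_eq_square)
      finally show ?thesis .
    qed
    have "t0 \<ge> 416 / 1000"
    proof -
      \<comment> \<open>A Taylor polynomial of degree 5 is used because the margin for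
        \<open>f t0\<close> is below 0.002.\<close>
      have "sin (416 / 1000) \<le> (416 / 1000 :: real) - (416 / 1000) ^ 3 / 6 + (416 / 1000) ^ 5 / 120"
        using Maclaurin_sin_bound[of "416 / 1000 :: real" 5]
        by (simp add: sin_coeff_def lessThan_nat_numeral fact_numeral power_numeral_reduce abs_if split: if_splits)
      also have "\<dots> \<le> sin t0" unfolding sin_t0 by (simp add: power_numeral_reduce)
      finally show ?thesis
        using sin_mono_le_eq[of "416/1000" t0] t0_bounds pi_gt3 by auto
    qed
    moreover have "f t0 = 81 / 100 * cos t0 - pi / 2 + 2 * t0"
      unfolding f_def by (simp add: sin_double sin_t0)
    ultimately show ?thesis using cos_t0 pi_approx(2) by simp
  qed
  ultimately have "f t \<ge> 0" by simp
  moreover have "cos t > 0" using t pi_gt_zero by (intro cos_gt_zero_pi) linarith+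
  ultimately show ?thesis unfolding t(3) mu_fun_def f_def by (simp add: field_simps)
qed

section \<open>Ruzsa's Sidon set\<close>

text \<open>Reducing the exponent modulo \<open>p - 1\<close> gives negative \<open>z\<close> a
  meaning and makes the set visibly periodic modulo \<open>p * (p - 1)\<close>.\<close>

definition ruzsa :: "nat \<Rightarrow> nat \<Rightarrow> int \<Rightarrow> bool" where
  "ruzsa p g z \<longleftrightarrow> [z = int g ^ nat (z mod (int p - 1))] (mod int p)"

locale primitive_root =
  fixes p g :: nat
  assumes p: "prime p" and p2: "p > 2" and g: "residue_primroot p g"
begin

lemma power_cong_iff: "[int g ^ i = int g ^ j] (mod int p) \<longleftrightarrow> [i = j] (mod (p - 1))"
proof -
  have "ord p g = p - 1" "coprime p g"
    using g p by (auto simp: residue_primroot_def totient_prime)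
  hence "[g ^ i = g ^ j] (mod p) \<longleftrightarrow> [i = j] (mod (p - 1))"
    using order_divides_expdiff by metis
  thus ?thesis
    by (metis cong_int_iff of_nat_power)
qed

lemma coprime_p_pred: "coprime (int p) (int p - 1)"
  by (rule coprime_doff_one_right)

text \<open>Members satisfy z \<equiv> g^z modulo p, and powers of a primitive root agree modulo p
  iff their exponents agree modulo p - 1.\<close>

lemma ruzsa_cong_iff:
  assumes "ruzsa p g x" "ruzsa p g y"
  shows "[x = y] (mod int p) \<longleftrightarrow> [x = y] (mod (int p - 1))"
proof -
  let ?f = "\<lambda>x. nat (x mod (int p - 1))"
  have "[x = y] (mod int p) \<longleftrightarrow> [int g ^ ?f x = int g ^ ?f y] (mod int p)"
    using assms unfolding ruzsa_def by (meson cong_sym cong_trans)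
  also have "\<dots> \<longleftrightarrow> [?f x = ?f y] (mod (p - 1))" by (rule power_cong_iff)
  also have "\<dots> \<longleftrightarrow> [int (?f x) = int (?f y)] (mod int (p - 1))"
    by (simp only: cong_int_iff)
  also have "\<dots> \<longleftrightarrow> [x mod (int p - 1) = y mod (int p - 1)] (mod (int p - 1))"
    using p2 by simp
  also have "[x mod (int p - 1) = y mod (int p - 1)] (mod (int p - 1)) \<longleftrightarrow> [x = y] (mod (int p - 1))"
    by (simp add: cong_def)
  finally show ?thesis .
qed

text \<open>Between members, adding \<open>d\<close> acts modulo p as multiplication by g^d, which
  makes the equation for \<open>x\<close> linear.\<close>

lemma ruzsa_add:
  assumes "ruzsa p g x" "ruzsa p g (x + d)"
  shows "[x + d = x * int g ^ nat (d mod (int p - 1))] (mod int p)"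
proof -
  let ?f = "\<lambda>x. nat (x mod (int p - 1))"
  have "[int (?f (x + d)) = int (?f x + ?f d)] (mod (int p - 1))"
    using p2 by (simp add: cong_def mod_simps)
  hence "[int (?f (x + d)) = int (?f x + ?f d)] (mod int (p - 1))"
    using p2 by (simp only: of_nat_diff of_nat_1)
  hence "[?f (x + d) = ?f x + ?f d] (mod (p - 1))" by (simp only: cong_int_iff)
  hence "[int g ^ ?f (x + d) = int g ^ (?f x + ?f d)] (mod int p)" by (simp only: power_cong_iff)
  hence "[x + d = int g ^ ?f x * int g ^ ?f d] (mod int p)"
    using assms(2) unfolding ruzsa_def power_add by (rule cong_trans[rotated])
  also have "[int g ^ ?f x * int g ^ ?f d = x * int g ^ ?f d] (mod int p)"
    using assms(1) unfolding ruzsa_def by (intro cong_mult) (auto intro: cong_sym)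
  finally show ?thesis .
qed

text \<open>Reduced modulo \<open>p - 1\<close>, the difference \<open>d\<close> of two dots determines the ratio of the dots
  modulo \<open>p\<close>; together with \<open>d\<close> modulo \<open>p\<close> it determines the dots.\<close>

lemma ruzsa_sidon:
  assumes "ruzsa p g x" "ruzsa p g (x + d)" "ruzsa p g y" "ruzsa p g (y + d)"
    and "\<not> [d = 0] (mod int p * (int p - 1))"
  shows "[x = y] (mod int p * (int p - 1))"
proof -
  define t where "t = int g ^ nat (d mod (int p - 1))"
  have x: "[x + d = x * t] (mod int p)" and y: "[y + d = y * t] (mod int p)"
    using assms ruzsa_add unfolding t_def by blast+
  have dvd_x: "int p dvd d - x * (t - 1)"
    using x by (simp add: cong_iff_dvd_diff algebra_simps)
  moreover have "int p dvd d - y * (t - 1)"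
    using y by (simp add: cong_iff_dvd_diff algebra_simps)
  ultimately have "int p dvd (d - y * (t - 1)) - (d - x * (t - 1))" by (rule dvd_diff[rotated])
  also have "(d - y * (t - 1)) - (d - x * (t - 1)) = (x - y) * (t - 1)" by (simp add: algebra_simps)
  finally have "int p dvd x - y \<or> int p dvd t - 1"
    using p by (simp add: prime_dvd_mult_iff)
  \<comment> \<open>If t \<equiv> 1, then p divides \<open>d\<close>, so \<open>x\<close> and
    \<open>x + d\<close> agree modulo p and, being members, modulo p - 1; this contradicts
    \<open>d\<close> being nonzero modulo p (p - 1).\<close>
  moreover have "\<not> int p dvd t - 1"
  proof
    assume "int p dvd t - 1"
    hence "int p dvd (d - x * (t - 1)) + x * (t - 1)" using dvd_x by (intro dvd_add dvd_mult)
    hence "int p dvd d" by simp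
    hence "[x + d = x] (mod int p)" by (simp add: cong_iff_dvd_diff)
    hence "[x + d = x] (mod (int p - 1))" using assms ruzsa_cong_iff by blast
    hence "int p - 1 dvd d" by (simp add: cong_iff_dvd_diff)
    with \<open>int p dvd d\<close> have "int p * (int p - 1) dvd d"
      using coprime_p_pred divides_mult by blast
    thus False using assms(5) by (simp add: cong_0_iff)
  qed
  ultimately have "[x = y] (mod int p)" by (simp add: cong_iff_dvd_diff)
  moreover from this have "[x = y] (mod (int p - 1))" using assms ruzsa_cong_iff by blast
  ultimately show ?thesis using coprime_p_pred by (rule coprime_cong_mult)
qed

text \<open>By the Chinese remainder theorem every residue class modulo p - 1 contains a member, and
  \<open>c\<close> merely translates the period.\<close>

lemma card_ruzsa_ge:
  "card {t \<in> {0..<int p * (int p - 1)}. ruzsa p g (c + t)} \<ge> p - 1"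
proof -
  let ?N = "int p * (int p - 1)"
  let ?X = "{t \<in> {0..<?N}. ruzsa p g (c + t)}"
  have "\<exists>t\<in>?X. (c + t) mod (int p - 1) = j" if j: "j \<in> {0..<int p - 1}" for j
  proof -
    have "\<exists>x. [x = int g ^ nat j] (mod int p) \<and> [x = j] (mod (int p - 1))"
      using coprime_p_pred by (rule binary_chinese_remainder_int)
    then obtain x where x: "[x = int g ^ nat j] (mod int p)" "[x = j] (mod (int p - 1))" by blast
    define t where "t = (x - c) mod ?N"
    have "?N > 0" using p2 by simp
    hence "t \<in> {0..<?N}" by (simp add: t_def)
    moreover have ct: "[c + t = x] (mod ?N)"
      unfolding t_def by (simp add: cong_def mod_simps)
    hence 1: "[c + t = x] (mod int p)" "[c + t = x] (mod (int p - 1))"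
      by (metis cong_modulus_mult) (metis ct cong_modulus_mult mult.commute)
    have 2: "(c + t) mod (int p - 1) = j"
      using cong_trans[OF 1(2) x(2)] j by (simp add: cong_def)
    moreover have "ruzsa p g (c + t)"
      unfolding ruzsa_def 2 using cong_trans[OF 1(1) x(1)] .
    ultimately show ?thesis by blast
  qed
  hence "{0..<int p - 1} \<subseteq> (\<lambda>t. (c + t) mod (int p - 1)) ` ?X" by blast
  moreover have fin: "finite ?X" by (rule finite_subset[of _ "{0..<?N}"]) auto
  ultimately have "card {0..<int p - 1} \<le> card ?X"
    by (meson card_image_le card_mono finite_imageI order_trans)
  thus ?thesis by (simp add: nat_diff_distrib)
qed

end

text \<open>Averaging: counting the pairs \<open>(s, t)\<close> in two ways, each \<open>s\<close>
  is hit by at least \<open>k\<close> of the \<open>N\<close> shifts.\<close>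

lemma exists_shift_card_ge:
  fixes S :: "'a set" and \<phi> :: "'a \<Rightarrow> int" and N k :: int
  assumes "finite S" "N > 0"
    and "\<And>c. int (card {t \<in> {0..<N}. P (c + t)}) \<ge> k"
  obtains t where "N * int (card {s \<in> S. P (\<phi> s + t)}) \<ge> k * int (card S)"
proof -
  have "\<exists>t\<in>{0..<N}. k * int (card S) \<le> N * int (card {s \<in> S. P (\<phi> s + t)})"
  proof (rule ccontr)
    assume "\<not> ?thesis"
    hence *: "N * int (card {s \<in> S. P (\<phi> s + t)}) < k * int (card S)" if "t \<in> {0..<N}" for t
      using that by force
    have "N * (\<Sum>t\<in>{0..<N}. int (card {s \<in> S. P (\<phi> s + t)})) =
          (\<Sum>t\<in>{0..<N}. N * int (card {s \<in> S. P (\<phi> s + t)}))" by (simp add: sum_distrib_left)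
    also have "\<dots> < (\<Sum>t\<in>{0..<N}. k * int (card S))"
      using * \<open>N > 0\<close> by (intro sum_strict_mono) auto
    also have "\<dots> = N * (k * int (card S))" using \<open>N > 0\<close> by simp
    finally have "(\<Sum>t\<in>{0..<N}. int (card {s \<in> S. P (\<phi> s + t)})) < k * int (card S)"
      using \<open>N > 0\<close> by simp
    also have "k * int (card S) = (\<Sum>s\<in>S. k)" by simp
    also have "\<dots> \<le> (\<Sum>s\<in>S. int (card {t \<in> {0..<N}. P (\<phi> s + t)}))"
      using assms by (intro sum_mono) auto
    also have "\<dots> = (\<Sum>s\<in>S. \<Sum>t\<in>{0..<N}. if P (\<phi> s + t) then 1 else 0)"
      by (intro sum.cong refl) (simp add: sum.If_cases Int_def)
    also have "\<dots> = (\<Sum>t\<in>{0..<N}. \<Sum>s\<in>S. if P (\<phi> s + t) then 1 else 0)" by (rule sum.swap)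
    also have "\<dots> = (\<Sum>t\<in>{0..<N}. int (card {s \<in> S. P (\<phi> s + t)}))"
      using assms(1) by (intro sum.cong refl) (simp add: sum.If_cases Int_def)
    finally show False by simp
  qed
  thus ?thesis using that by blast
qed

section \<open>Nearly hexagonal lattices\<close>

text \<open>
  The lattice \<open>x + a y \<equiv> 0 mod N\<close> is spanned by \<open>(-a, 1)\<close> and \<open>(c, k)\<close>, and it is nearly hexagonal
  if \<open>c\<close> is close to \<open>a / 2\<close> and \<open>a / k\<close> to \<open>2 / sqrt 3\<close>, for which \<open>8 / 7\<close> is good enough. The
  former means that \<open>a (2 k + 1)\<close> is close to \<open>2 N\<close>. With \<open>a = 4 (w + i)\<close> and
  \<open>2 k + 1 = 7 (w - i)\<close> this product is \<open>28 (w\<^sup>2 - i\<^sup>2)\<close>, where \<open>w\<close> is the least integer with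
  \<open>14 w\<^sup>2 \<ge> N\<close>, and a suitable \<open>i = O(sqrt p)\<close> of the right parity corrects the excess.
\<close>

lemma hex_lattice_basis:
  fixes p :: nat
  assumes "p \<ge> 2"
  obtains a k c :: int
  where "int p * (int p - 1) = a * k + c"
    "\<bar>a - 4 / sqrt 14 * p\<bar> \<le> 56 * sqrt p + 14"
    "\<bar>k - 7 / (2 * sqrt 14) * p\<bar> \<le> 56 * sqrt p + 14"
    "\<bar>c - a / 2\<bar> \<le> 56 * sqrt p + 14"
proof -
  define N :: int where "N = int p * (int p - 1)"
  define q where "q = sqrt (N / 14)"
  define w where "w = \<lceil>q\<rceil>"
  define s where "s = sqrt ((real_of_int w)\<^sup>2 - N / 14)"
  \<comment> \<open>\<open>i = s\<close> would give \<open>c = a / 2\<close> exactly; the correction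
    by 0 or 1 makes \<open>w - i\<close> odd, so that \<open>2 * k + 1 = 7 * (w - i)\<close> is
    solvable.\<close>
  define i where "i = \<lfloor>s\<rfloor> + (if odd (w - \<lfloor>s\<rfloor>) then 0 else 1)"
  define a where "a = 4 * (w + i)"
  define k where "k = (7 * (w - i) - 1) div 2"
  define c where "c = N - a * k"
  have Np: "real_of_int N = real p * (real p - 1)" by (simp add: N_def)
  have N: "real_of_int N > 0" using assms unfolding Np by simp
  have q: "q > 0" "q\<^sup>2 = N / 14" using N by (simp_all add: q_def)
  have s14: "sqrt 14 > (1 :: real)" "(sqrt 14)\<^sup>2 = (14 :: real)" by simp_all
  have q14: "q = sqrt N / sqrt 14" by (simp add: q_def real_sqrt_divide)
  have "sqrt N \<le> p" unfolding Np by (intro real_le_lsqrt) (auto simp: power2_eq_square algebra_simps)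
  hence qp: "q \<le> p / sqrt 14" unfolding q14 by (simp add: divide_right_mono)
  have "real p - 1 \<le> sqrt N" unfolding Np using assms
    by (intro real_le_rsqrt) (auto simp: power2_eq_square algebra_simps)
  hence "(real p - 1) / sqrt 14 \<le> q" unfolding q14 by (simp add: divide_right_mono)
  moreover have "1 / sqrt 14 \<le> (1 :: real)" by simp
  ultimately have pq: "p / sqrt 14 - 1 \<le> q" unfolding diff_divide_distrib by linarith
  have w: "q \<le> w" "w < q + 1" unfolding w_def by linarith+
  define u where "u = w - p / sqrt 14"
  have u: "\<bar>u\<bar> \<le> 1" using w qp pq unfolding u_def by linarith
  have "q\<^sup>2 \<le> (real_of_int w)\<^sup>2" using w q by (intro power_mono) auto
  hence s: "s \<ge> 0" "s\<^sup>2 = (real_of_int w)\<^sup>2 - N / 14" unfolding s_def using q by simp_all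
  have "s\<^sup>2 = (w - q) * (w + q)" unfolding s q(2)[symmetric] by (simp add: power2_eq_square algebra_simps)
  also have "\<dots> \<le> 1 * (w + q)" using w q by (intro mult_right_mono) auto
  also have "\<dots> \<le> 2 * q + 1" using w by simp
  also have "q \<le> p"
  proof -
    have "p / sqrt 14 \<le> p" using s14 mult_left_mono[of 1 "sqrt 14" "real p"] by (simp add: field_simps)
    thus ?thesis using qp by linarith
  qed
  also have "2 * real p + 1 \<le> 4 * p" using assms by simp
  finally have "s \<le> sqrt (4 * p)" by (intro real_le_rsqrt) simp
  also have "\<dots> = 2 * sqrt p" by (simp add: real_sqrt_mult)
  finally have sp: "s \<le> 2 * sqrt p" by simp
  have i: "\<bar>i - s\<bar> \<le> 1" "i \<ge> 0" using s(1) unfolding i_def by (auto; linarith)+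
  have "odd (w - i)" unfolding i_def by auto
  hence k2: "2 * k + 1 = 7 * (w - i)" unfolding k_def by (auto elim!: oddE)
  have k2': "real_of_int k = (7 * (w - i) - 1) / 2" using arg_cong[OF k2, of real_of_int] by simp
  have a': "real_of_int a = 4 * (w + i)" by (simp add: a_def)
  have "c - a / 2 = N - a * (real_of_int k + 1 / 2)" by (simp add: c_def algebra_simps)
  also have "\<dots> = N - 14 * ((real_of_int w)\<^sup>2 - (real_of_int i)\<^sup>2)" unfolding k2' a' by (simp add: power2_eq_square field_simps)
  also have "\<dots> = 14 * ((real_of_int i)\<^sup>2 - s\<^sup>2)" unfolding s by simp
  also have "\<dots> = 14 * ((i - s) * (i + s))" by (simp add: power2_eq_square algebra_simps)
  finally have "\<bar>c - a / 2\<bar> = 14 * (\<bar>i - s\<bar> * \<bar>i + s\<bar>)" by (simp add: abs_mult)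
  also have "\<dots> \<le> 14 * (1 * (2 * s + 1))" using i s by (intro mult_left_mono mult_mono) auto
  finally have "\<bar>c - a / 2\<bar> \<le> 56 * sqrt p + 14" using sp by simp
  moreover have "\<bar>a - 4 / sqrt 14 * p\<bar> \<le> 56 * sqrt p + 14"
  proof -
    have "a - 4 / sqrt 14 * p = 4 * u + 4 * real_of_int i" by (simp add: a' u_def algebra_simps)
    thus ?thesis using u i(1) sp s(1) by linarith
  qed
  moreover have "\<bar>k - 7 / (2 * sqrt 14) * p\<bar> \<le> 56 * sqrt p + 14"
  proof -
    have "k - 7 / (2 * sqrt 14) * p = 7 / 2 * u - 7 / 2 * real_of_int i - 1 / 2"
      by (simp add: k2' u_def algebra_simps diff_divide_distrib)
    thus ?thesis using u i(1) sp s(1) by linarith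
  qed
  ultimately show ?thesis using that[of a k c] by (simp add: c_def N_def)
qed

text \<open>Here 4 / sqrt 14 = 1.06904... and 7 / (2 sqrt 14) = 0.93541...; the decimals leave room
  for the O(sqrt p) error.\<close>

lemma eventually_hex_lattice_basis:
  "eventually (\<lambda>p :: nat. \<exists>a k c :: int. int p * (int p - 1) = a * k + c \<and>
     1.06902 * p \<le> a \<and> a \<le> 1.0691 * p \<and> 0.9353 * p \<le> k  \<and>
     0.5344 * p \<le> c \<and> c \<le> 0.5347 * p) sequentially"
proof -
  have "eventually (\<lambda>p :: nat. 56 * sqrt p + 14 \<le> 0.00001 * p) sequentially"
    by real_asymp
  thus ?thesis
    using eventually_ge_at_top[of 2]
  proof eventually_elim
    case (elim p)
    obtain a k c :: int where akc: "int p * (int p - 1) = a * k + c"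
      "\<bar>a - 4 / sqrt 14 * p\<bar> \<le> 56 * sqrt p + 14"
      "\<bar>k - 7 / (2 * sqrt 14) * p\<bar> \<le> 56 * sqrt p + 14"
      "\<bar>c - a / 2\<bar> \<le> 56 * sqrt p + 14"
      using hex_lattice_basis[OF elim(2)] by blast
    have "sqrt 14 \<ge> (3.74165 :: real)"
      by (rule real_le_rsqrt) (simp add: power2_eq_square)
    moreover have "sqrt 14 \<le> (3.74166 :: real)"
      by (rule real_le_lsqrt) (simp_all add: power2_eq_square)
    ultimately have "1.06904 \<le> 4 / sqrt (14 :: real)" "4 / sqrt (14 :: real) \<le> 1.06905"
      "0.93541 \<le> 7 / (2 * sqrt (14 :: real))" "7 / (2 * sqrt (14 :: real)) \<le> 0.93542"
      by (simp_all add: field_simps)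
    from this[THEN mult_right_mono[of _ _ "real p"]]
    have "1.06904 * p \<le> 4 / sqrt 14 * p" "4 / sqrt 14 * p \<le> 1.06905 * p"
      "0.93541 * p \<le> 7 / (2 * sqrt 14) * p" "7 / (2 * sqrt 14) * p \<le> 0.93542 * p"
      by simp_all
    hence "1.06902 * p \<le> a \<and> a \<le> 1.0691 * p \<and> 0.9353 * p \<le> k  \<and>
     0.5344 * p \<le> c \<and> c \<le> 0.5347 * p"
      using akc(2-4) elim(1) by (intro conjI; simp)
    thus ?case using akc(1) by blast
  qed
qed

section \<open>Grid points in a disc with caps removed\<close>

text \<open>Comparison with the integral of sqrt, used below to add up the boxes covering a
  cap.\<close>

lemma sum_sqrt_le: "(\<Sum>j<m. sqrt (real j + 1)) \<le> 2 / 3 * ((real m + 1) * sqrt (real m + 1))"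
proof (induction m)
  case (Suc m)
  define s t where "s = sqrt (real m + 1)" and "t = sqrt (real m + 2)"
  have st: "s > 0" "s \<le> t" "s * s = real m + 1" "t * t = real m + 2"
    by (auto simp: s_def t_def)
  have "s * t \<le> t * t" "s * s \<le> t * t" using st(1,2) by (auto intro!: mult_mono)
  \<comment> \<open>Both factors are nonnegative; after inserting the values of \<open>s * s\<close>
    and \<open>t * t\<close>, the expanded product is three times the gap in the induction
    step.\<close>
  hence "0 \<le> (t - s) * (2 * (t * t) - s * t - s * s)" using st by simp
  also have "\<dots> = 2 * (t * (t * t)) + s * (s * s) - 3 * (s * (t * t))"
    by (simp add: algebra_simps)
  finally have "s + 2 / 3 * ((real m + 1) * s) \<le> 2 / 3 * ((real m + 2) * t)"
    unfolding st by (simp add: field_simps)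
  thus ?case using Suc by (simp add: s_def t_def add_ac)
qed auto

section \<open>Areas of circular caps\<close>

definition cap :: "real ^ 2 \<Rightarrow> real \<Rightarrow> real \<Rightarrow> (real ^ 2) set" where
  "cap n R h = {z. norm z \<le> R \<and> z \<bullet> n \<ge> h}"

lemma compact_cap: "compact (cap n R h)"
proof -
  have "cap n R h = cball 0 R \<inter> {z. h \<le> n \<bullet> z}"
    by (auto simp: cap_def inner_commute)
  thus ?thesis by (simp add: closed_halfspace_ge compact_Int_closed)
qed

lemma lmeasurable_cap [simp, intro]: "cap n R h \<in> lmeasurable"
  using compact_cap by (rule lmeasurable_compact)

lemma measure_cbox_vec2:
  assumes "a \<le> b" "c \<le> d"
  shows "measure lebesgue (cbox (vector [a, c] :: real ^ 2) (vector [b, d])) = (b - a) * (d - c)"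
proof -
  have "measure lebesgue (cbox (vector [a, c] :: real ^ 2) (vector [b, d])) =
        measure lborel (cbox (vector [a, c] :: real ^ 2) (vector [b, d]))" by simp
  also have "\<dots> = (b - a) * (d - c)"
    using assms by (subst content_cbox_cart) (auto simp: interval_ne_empty_cart forall_2 prod.insert UNIV_2)
  finally show ?thesis .
qed

text \<open>At depth u = R - \<open>z $ 1\<close> the cap lies inside the parabola
  \<open>z $ 2\<close> ^ 2 \<le> 2 R u, and the bound is the area of this parabolic segment. It is
  reached by covering with \<open>m\<close> boxes and letting \<open>m\<close> tend to
  infinity.\<close>

lemma measure_cap_axis_le:
  assumes "R > 0" "h \<le> R"
  shows "measure lebesgue (cap (axis 1 1) R h) \<le>
           4 * sqrt 2 / 3 * sqrt R * ((R - h) * sqrt (R - h))"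
proof -
  define e where "e = R - h"
  have e: "e \<ge> 0" using assms by (simp add: e_def)
  define B where "B = 4 * sqrt 2 / 3 * sqrt R * (e * sqrt e)"
  have "measure lebesgue (cap (axis 1 1) R h) \<le>
          B * ((real m + 1) / m * sqrt ((real m + 1) / m))" if m: "m > 0" for m :: nat
  proof -
    define d where "d = e / m"
    have d: "d \<ge> 0" using e by (simp add: d_def)
    define b where "b j = sqrt (2 * R * (real j + 1) * d)" for j :: nat
    have b: "b j \<ge> 0" for j using assms d by (simp add: b_def)
    \<comment> \<open>The slab of depths from \<open>j * d\<close> to \<open>(j + 1) * d\<close>, as
      high as the parabola at its deeper end.\<close>
    define Q where "Q j = cbox (vector [R - (real j + 1) * d, - b j] :: real ^ 2) (vector [R - real j * d, b j])" for j :: nat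
    have "cap (axis 1 1) R h \<subseteq> (\<Union>j<m. Q j)"
    proof
      fix z assume "z \<in> cap (axis 1 1) R h"
      hence z: "norm z \<le> R" "h \<le> z $ 1" by (auto simp: cap_def inner_axis)
      have "\<bar>z $ 1\<bar> \<le> R" using z component_le_norm_cart[of z 1] by linarith
      have "(norm z)\<^sup>2 = (z $ 1)\<^sup>2 + (z $ 2)\<^sup>2"
        unfolding power2_norm_eq_inner by (simp add: inner_vec_def sum_2 power2_eq_square)
      moreover have "(norm z)\<^sup>2 \<le> R\<^sup>2" using z by (intro power_mono) auto
      ultimately have "(z $ 2)\<^sup>2 \<le> R\<^sup>2 - (z $ 1)\<^sup>2" by simp
      also have "\<dots> = (R - z $ 1) * (2 * R - (R - z $ 1))" by (simp add: power2_eq_square algebra_simps)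
      also have "\<dots> \<le> (R - z $ 1) * (2 * R)" using \<open>\<bar>z $ 1\<bar> \<le> R\<close> by (intro mult_left_mono) auto
      finally have z2: "(z $ 2)\<^sup>2 \<le> 2 * R * (R - z $ 1)" by (simp add: mult_ac)
      have "\<exists>j<m. real j * d \<le> R - z $ 1 \<and> R - z $ 1 \<le> (real j + 1) * d"
      proof (cases "d = 0")
        case True
        hence "e = 0" using m by (simp add: d_def)
        hence "R - z $ 1 = 0" using z \<open>\<bar>z $ 1\<bar> \<le> R\<close> by (simp add: e_def)
        thus ?thesis using m True by auto
      next
        case False
        define s where "s = (R - z $ 1) / d"
        have s: "R - z $ 1 = s * d" "s \<ge> 0" using False d \<open>\<bar>z $ 1\<bar> \<le> R\<close> by (auto simp: s_def)
        have "s * d \<le> m * d" using z m by (simp only: s(1)[symmetric]) (simp add: d_def e_def)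
        hence sm: "s \<le> m" using False d by simp
        show ?thesis
        proof (cases "s = m")
          case True
          \<comment> \<open>Points of full depth, with \<open>z $ 1 = h\<close>, go into the last
            box.\<close>
          show ?thesis unfolding s(1) using d m True
            by (intro exI[of _ "m - 1"]) (auto simp: of_nat_diff intro!: mult_right_mono)
        next
          case False
          hence "s < m" using sm by simp
          moreover have "real (nat \<lfloor>s\<rfloor>) \<le> s" "s \<le> real (nat \<lfloor>s\<rfloor>) + 1" using s(2) by linarith+
          ultimately show ?thesis unfolding s(1) using d
            by (intro exI[of _ "nat \<lfloor>s\<rfloor>"]) (auto intro!: mult_right_mono)
        qed
      qed
      then obtain j where j: "j < m" "real j * d \<le> R - z $ 1" "R - z $ 1 \<le> (real j + 1) * d" by blast
      have "(z $ 2)\<^sup>2 \<le> 2 * R * ((real j + 1) * d)"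
        using z2 mult_left_mono[OF j(3), of "2 * R"] assms by linarith
      hence "\<bar>z $ 2\<bar> \<le> b j" unfolding b_def by (intro real_le_rsqrt) (simp add: mult_ac)
      hence "z \<in> Q j" using j by (auto simp: Q_def mem_box_cart forall_2)
      thus "z \<in> (\<Union>j<m. Q j)" using j by blast
    qed
    hence "measure lebesgue (cap (axis 1 1) R h) \<le> measure lebesgue (\<Union>j<m. Q j)"
      by (intro measure_mono_fmeasurable) (auto simp: Q_def fmeasurableD intro!: fmeasurable_UN fmeasurable.finite_UN)
    also have "\<dots> \<le> (\<Sum>j<m. measure lebesgue (Q j))"
      by (intro measure_UNION_le) (auto simp: Q_def)
    also have "\<dots> = (\<Sum>j<m. d * (2 * b j))"
      unfolding Q_def using b d by (intro sum.cong refl, subst measure_cbox_vec2) (auto simp: algebra_simps minus_le_iff intro: order_trans[OF _ b])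
    also have "\<dots> = 2 * d * sqrt (2 * R * d) * (\<Sum>j<m. sqrt (real j + 1))"
      unfolding sum_distrib_left b_def
      by (intro sum.cong refl) (simp add: real_sqrt_mult)
    also have "\<dots> \<le> 2 * d * sqrt (2 * R * d) * (2 / 3 * ((real m + 1) * sqrt (real m + 1)))"
      using d assms by (intro mult_left_mono sum_sqrt_le) auto
    also have "\<dots> = B * ((real m + 1) / m * sqrt ((real m + 1) / m))"
      unfolding B_def d_def using m by (simp add: real_sqrt_mult real_sqrt_divide mult_ac)
    finally show ?thesis .
  qed
  hence "eventually (\<lambda>m. measure lebesgue (cap (axis 1 1) R h) \<le>
          B * ((real m + 1) / m * sqrt ((real m + 1) / m))) sequentially"
    by (auto intro: eventually_mono[OF eventually_gt_at_top[of 0]])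
  moreover have "(\<lambda>m. B * ((real m + 1) / m * sqrt ((real m + 1) / m))) \<longlonglongrightarrow> B"
    by real_asymp
  ultimately have "measure lebesgue (cap (axis 1 1) R h) \<le> B"
    using tendsto_lowerbound sequentially_bot by blast
  thus ?thesis by (simp add: B_def e_def)
qed

text \<open>A rotation takes the first axis to \<open>n\<close>; the truncation by
  \<open>max 0\<close> accounts for \<open>h > R\<close>, where the cap is empty.\<close>

lemma measure_cap_le:
  assumes "R > 0" "norm n = 1"
  shows "measure lebesgue (cap n R h) \<le>
           4 * sqrt 2 / 3 * sqrt R * (max 0 (R - h) * sqrt (max 0 (R - h)))"
proof (cases "h \<le> R")
  case True
  obtain f :: "real ^ 2 \<Rightarrow> real ^ 2" where f: "orthogonal_transformation f" "f (axis 1 1) = n"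
    using orthogonal_transformation_exists_1[of "axis 1 1" n] assms by auto
  have fn: "norm (f z) = norm z" "f z \<bullet> n = z \<bullet> axis 1 1" for z
    using f by (auto simp: orthogonal_transformation_norm) (auto simp: orthogonal_transformation_def)
  have "surj f" using f(1) by (rule orthogonal_transformation_surj)
  hence "cap n R h = f ` cap (axis 1 1) R h"
    unfolding cap_def using fn by (auto simp: image_iff) (metis surjD)
  hence "measure lebesgue (cap n R h) = measure lebesgue (cap (axis 1 1) R h)"
    using measure_orthogonal_image[OF f(1)] by simp
  thus ?thesis using measure_cap_axis_le[OF assms(1) True] True by simp
next
  case False
  have "\<not> (norm z \<le> R \<and> z \<bullet> n \<ge> h)" for z
    using norm_cauchy_schwarz[of z n] assms False by auto
  hence "cap n R h = {}" unfolding cap_def by blast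
  thus ?thesis using assms by simp
qed

section \<open>Grid points in a truncated Voronoi cell\<close>

definition lat :: "int \<times> int \<Rightarrow> real ^ 2" where
  "lat z = vector [of_int (fst z), of_int (snd z)]"

lemma lat_nth [simp]: "lat z $ 1 = of_int (fst z)" "lat z $ 2 = of_int (snd z)"
  by (simp_all add: lat_def)

lemma lat_diff: "lat (y - z) = lat y - lat z"
  by (simp add: vec_eq_iff forall_2)

lemma norm_lat: "norm (lat z) = sqrt (of_int (fst z) ^ 2 + of_int (snd z) ^ 2)"
  by (simp add: norm_eq_sqrt_inner inner_vec_def sum_2 power2_eq_square)

text \<open>The open Voronoi cell of \<open>0\<close> with respect to the vectors \<open>W\<close>, cut by a disc.\<close>

definition cell :: "real \<Rightarrow> (int \<times> int) set \<Rightarrow> (int \<times> int) set" where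
  "cell R W = {z. norm (lat z) \<le> R \<and> (\<forall>w\<in>W. 2 * (lat z \<bullet> lat w) < (norm (lat w))\<^sup>2)}"

lemma finite_cell: "finite (cell R W)"
proof (rule finite_subset)
  show "cell R W \<subseteq> {-\<lceil>R\<rceil>..\<lceil>R\<rceil>} \<times> {-\<lceil>R\<rceil>..\<lceil>R\<rceil>}"
  proof
    fix z assume "z \<in> cell R W"
    hence "norm (lat z) \<le> R" by (simp add: cell_def)
    hence "\<bar>real_of_int (fst z)\<bar> \<le> R" "\<bar>real_of_int (snd z)\<bar> \<le> R"
      using component_le_norm_cart[of "lat z" 1] component_le_norm_cart[of "lat z" 2] by auto
    hence "\<bar>fst z\<bar> \<le> \<lceil>R\<rceil>" "\<bar>snd z\<bar> \<le> \<lceil>R\<rceil>" by linarith+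
    thus "z \<in> {-\<lceil>R\<rceil>..\<lceil>R\<rceil>} \<times> {-\<lceil>R\<rceil>..\<lceil>R\<rceil>}" by (cases z) auto
  qed
qed auto

text \<open>The unit squares around the grid points of the cell, together with the caps, cover the
  disc of radius \<open>R - 1\<close>: rounding moves a point by at most 1, so a point outside all
  caps rounds to a grid point on the near side of every bisector. This is why both \<open>R\<close>
  and \<open>h\<close> lose 1.\<close>

lemma card_cell_ge:
  assumes "R \<ge> 1" "finite W" and W: "\<And>w. w \<in> W \<Longrightarrow> h \<le> norm (lat w) / 2 - 1" and "h > 0"
  shows "real (card (cell R W)) \<ge> pi * (R - 1)\<^sup>2 -
           card W * (4 * sqrt 2 / 3 * sqrt R * (max 0 (R - h) * sqrt (max 0 (R - h))))"
proof -
  define M where "M = 4 * sqrt 2 / 3 * sqrt R * (max 0 (R - h) * sqrt (max 0 (R - h)))"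
  define n where "n w = lat w /\<^sub>R norm (lat w)" for w
  define C where "C = (\<Union>w\<in>W. cap (n w) R h)"
  define Q where "Q z = cbox (vector [real_of_int (fst z) - 1/2, real_of_int (snd z) - 1/2] :: real ^ 2)
      (vector [real_of_int (fst z) + 1/2, real_of_int (snd z) + 1/2])" for z
  have W0: "norm (lat w) > 0" if "w \<in> W" for w using W[OF that] \<open>h > 0\<close> by linarith
  have "cball 0 (R - 1) \<subseteq> C \<union> (\<Union>z\<in>cell R W. Q z)"
  proof
    fix x :: "real ^ 2" assume x: "x \<in> cball 0 (R - 1)"
    define z where "z = (round (x $ 1), round (x $ 2))"
    have r: "\<bar>x $ 1 - round (x $ 1)\<bar> \<le> 1 / 2" "\<bar>x $ 2 - round (x $ 2)\<bar> \<le> 1 / 2"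
      using of_int_round_abs_le[of "x $ 1"] of_int_round_abs_le[of "x $ 2"] by (simp_all add: abs_minus_commute)
    hence "x \<in> Q z" unfolding Q_def z_def by (auto simp: mem_box_cart forall_2 abs_if split: if_splits)
    have "norm (x - lat z) \<le> \<bar>(x - lat z) $ 1\<bar> + \<bar>(x - lat z) $ 2\<bar>"
      using norm_le_l1_cart[of "x - lat z"] by (simp add: sum_2)
    also have "\<dots> \<le> 1" using r by (simp add: z_def)
    finally have xz: "norm (x - lat z) \<le> 1" .
    have "norm (lat z) \<le> norm x + norm (x - lat z)" by norm
    hence zR: "norm (lat z) \<le> R" using xz x by simp
    show "x \<in> C \<union> (\<Union>z\<in>cell R W. Q z)"
    proof (cases "x \<in> C")
      case False
      have "2 * (lat z \<bullet> lat w) < (norm (lat w))\<^sup>2" if w: "w \<in> W" for w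
      proof -
        have nw: "lat w = norm (lat w) *\<^sub>R n w" using W0[OF w] by (simp add: n_def)
        have "x \<bullet> n w < h" using False w x by (force simp: C_def cap_def)
        moreover have "lat z \<bullet> n w = x \<bullet> n w - (x - lat z) \<bullet> n w" by (simp add: inner_diff_left)
        moreover have "\<bar>(x - lat z) \<bullet> n w\<bar> \<le> 1 * 1"
          using Cauchy_Schwarz_ineq2[of "x - lat z" "n w"] xz W0[OF w] by (simp add: n_def)
        ultimately have "lat z \<bullet> n w < norm (lat w) / 2" using W[OF w] by linarith
        hence "norm (lat w) * (lat z \<bullet> n w) < norm (lat w) * (norm (lat w) / 2)"
          using W0[OF w] by (intro mult_strict_left_mono)
        also have "norm (lat w) * (lat z \<bullet> n w) = lat z \<bullet> lat w"
          by (subst (2) nw) simp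
        finally show ?thesis by (simp add: power2_eq_square)
      qed
      hence "z \<in> cell R W" using zR by (simp add: cell_def)
      thus ?thesis using \<open>x \<in> Q z\<close> by blast
    qed auto
  qed
  moreover have CM: "C \<in> lmeasurable" "(\<Union>z\<in>cell R W. Q z) \<in> lmeasurable"
    unfolding C_def Q_def using assms finite_cell by (auto intro!: fmeasurable.finite_UN)
  ultimately have "measure lebesgue (cball (0 :: real ^ 2) (R - 1)) \<le>
      measure lebesgue (C \<union> (\<Union>z\<in>cell R W. Q z))"
    by (intro measure_mono_fmeasurable) (auto intro: fmeasurable.Un)
  also have "\<dots> \<le> measure lebesgue C + measure lebesgue (\<Union>z\<in>cell R W. Q z)"
    using CM by (intro measure_Un_le) (auto dest: fmeasurableD)
  also have "measure lebesgue C \<le> (\<Sum>w\<in>W. measure lebesgue (cap (n w) R h))"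
    unfolding C_def using assms by (intro measure_UNION_le) (auto intro: fmeasurableD)
  also have "\<dots> \<le> (\<Sum>w\<in>W. M)"
    unfolding M_def using assms W0 by (intro sum_mono measure_cap_le) (auto simp: n_def)
  also have "\<dots> = card W * M" by simp
  also have "measure lebesgue (\<Union>z\<in>cell R W. Q z) \<le> (\<Sum>z\<in>cell R W. measure lebesgue (Q z))"
    using finite_cell by (intro measure_UNION_le) (auto simp: Q_def)
  also have "\<dots> = (\<Sum>z\<in>cell R W. 1)"
    unfolding Q_def by (intro sum.cong refl, subst measure_cbox_vec2) auto
  also have "\<dots> = card (cell R W)" by simp
  also have "measure lebesgue (cball (0 :: real ^ 2) (R - 1)) = pi * (R - 1)\<^sup>2"
    using assms content_cball[of "R - 1" "0 :: real ^ 2"] by (simp add: unit_ball_vol_2)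
  finally show ?thesis unfolding M_def by simp
qed

section \<open>The construction\<close>

text \<open>The two basis vectors, their sum, and the negatives: the six neighbours of the origin in
  a nearly hexagonal lattice.\<close>

definition hex_vectors :: "int \<Rightarrow> int \<Rightarrow> int \<Rightarrow> (int \<times> int) set" where
  "hex_vectors a k c =
     {(-a, 1), (c, k), (c - a, k + 1), (a, -1), (-c, -k), (a - c, -k - 1)}"

text \<open>Write \<open>(x, y)\<close> as \<open>i\<close> times (-a, 1) plus \<open>j\<close>
  times (c, k). Then x + a y = N j is smaller than 2 N in absolute value, so \<open>j\<close> is -1,
  0 or 1, and the bound on \<open>x\<close> leaves only a few values of \<open>i\<close>.\<close>

lemma short_lattice_vectors:
  fixes a k c N x y :: int and p r :: real
  assumes p: "p \<ge> 1000" and N: "N = a * k + c" "real_of_int N = p * (p - 1)"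
    and a: "1.06902 * p \<le> a" "a \<le> 1.0691 * p"
    and c: "0.5344 * p \<le> c" "c \<le> 0.5347 * p"
    and r: "r \<le> 1.2122 * p"
    and xy: "\<bar>real_of_int x\<bar> \<le> r" "\<bar>real_of_int y\<bar> \<le> r" "(x, y) \<noteq> 0" "N dvd x + a * y"
  shows "(x, y) \<in> hex_vectors a k c"
proof -
  obtain j where j: "x + a * y = N * j" using xy(4) by blast
  define i where "i = y - j * k"
  have y: "y = i + j * k" by (simp add: i_def)
  have x: "x = j * c - a * i"
    using j unfolding N(1) y by (simp add: algebra_simps)
  have a0: "a > 0" using a p by (simp flip: of_int_0_less_iff)
  have N0: "real_of_int N > 0" unfolding N(2) using p by simp
  have "\<bar>j\<bar> \<le> 1"
  proof (rule ccontr)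
    assume "\<not> ?thesis"
    hence "2 * real_of_int N \<le> \<bar>real_of_int j\<bar> * N"
      using N0 by (intro mult_right_mono) linarith+
    also have "\<dots> = \<bar>real_of_int x + a * y\<bar>"
      using arg_cong[OF j, of real_of_int] N0 by (simp add: abs_mult mult.commute)
    also have "\<dots> \<le> \<bar>real_of_int x\<bar> + \<bar>real_of_int a * y\<bar>" by (metis abs_triangle_ineq of_int_mult)
    also have "\<dots> = \<bar>real_of_int x\<bar> + a * \<bar>real_of_int y\<bar>" using a0 by (simp add: abs_mult)
    also have "\<dots> \<le> 1.2122 * p + 1.0691 * p * (1.2122 * p)"
      using xy r a p a0 by (intro add_mono mult_mono) auto
    finally have "2 * (p * (p - 1)) \<le> 1.2122 * p + 1.0691 * p * (1.2122 * p)" unfolding N(2) .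
    hence "p * (2 * (p - 1)) \<le> p * (1.2122 + 1.0691 * 1.2122 * p)" by (simp add: algebra_simps)
    hence "2 * (p - 1) \<le> 1.2122 + 1.0691 * 1.2122 * p" using p by (subst (asm) mult_le_cancel_left_pos) auto
    thus False using p by simp
  qed
  hence j3: "j = 0 \<or> j = 1 \<or> j = -1" by linarith
  have xr: "\<bar>real_of_int j * c - real_of_int a * i\<bar> \<le> 1.2122 * p"
    using xy(1) r unfolding x by simp
  have xr1: "real_of_int a * i \<le> real_of_int j * c + 1.2122 * p"
    and xr2: "real_of_int j * c - 1.2122 * p \<le> real_of_int a * i"
    using xr unfolding abs_le_iff by simp_all
  have upper: "i < m" if "1.2122 * p + real_of_int j * c < real_of_int a * m" for m
  proof (rule ccontr)
    assume "\<not> i < m"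
    hence "real_of_int a * m \<le> real_of_int a * i" using a0 by (intro mult_left_mono) auto
    thus False using xr1 that by argo
  qed
  have lower: "i > m" if "real_of_int a * m < real_of_int j * c - 1.2122 * p" for m
  proof (rule ccontr)
    assume "\<not> i > m"
    hence "real_of_int a * m \<ge> real_of_int a * i" using a0 by (intro mult_left_mono) auto
    thus False using xr2 that by argo
  qed
  have "i < 2 \<and> i > -2" if "j = 0"
    by (intro conjI upper lower) (use that a p in auto)
  moreover have "i < 2 \<and> i > -1" if "j = 1"
    by (intro conjI upper lower) (use that a c p in auto)
  moreover have "i < 1 \<and> i > -2" if "j = -1"
    by (intro conjI upper lower) (use that a c p in auto)
  ultimately consider "j = 0" "\<bar>i\<bar> \<le> 1" | "j = 1" "i = 0 \<or> i = 1" | "j = -1" "i = 0 \<or> i = -1"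
    using j3 by force
  thus ?thesis
  proof cases
    case 1
    hence "i = 1 \<or> i = -1" using xy(3) x y by (auto simp: zero_prod_def)
    thus ?thesis using 1 x y by (auto simp: hex_vectors_def)
  qed (use x y in \<open>auto simp: hex_vectors_def\<close>)
qed

text \<open>Since \<open>c\<close> and \<open>a - c\<close> are both near \<open>a / 2\<close>, the
  slanted vectors have length at least about 1.077 p, and the shortest is (-a, 1) up to
  sign.\<close>

lemma norm_hex_vectors_ge:
  assumes p: "p \<ge> 0" and a: "1.06902 * p \<le> real_of_int a" 
    and k: "0.9353 * p \<le> k"
    and c: "0.5344 * p \<le> c" "c \<le> 0.5347 * p"
    and "w \<in> hex_vectors a k c"
  shows "1.06902 * p \<le> norm (lat w)"
proof -
  have *: "1.06902 * p \<le> sqrt (x\<^sup>2 + y\<^sup>2)" if "0.5343 * p \<le> \<bar>x\<bar>" "0.9353 * p \<le> \<bar>y\<bar>" for x y :: real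
  proof (intro real_le_rsqrt)
    have "(1.06902 * p)\<^sup>2 \<le> (0.5343 * p)\<^sup>2 + (0.9353 * p)\<^sup>2"
      by (simp add: power2_eq_square)
    also have "\<dots> \<le> \<bar>x\<bar>\<^sup>2 + \<bar>y\<bar>\<^sup>2" using that p by (intro add_mono power_mono) auto
    finally show "(1.06902 * p)\<^sup>2 \<le> x\<^sup>2 + y\<^sup>2" by simp
  qed
  have "1.06902 * p \<le> sqrt (x\<^sup>2 + 1)" if "1.06902 * p \<le> \<bar>x\<bar>" for x :: real
    using that real_sqrt_le_mono[of "x\<^sup>2" "x\<^sup>2 + 1"] by simp
  moreover have "1.06902 * p \<le> \<bar>real_of_int a\<bar>" using a by simp
  moreover have "1.06902 * p \<le> sqrt ((real_of_int c)\<^sup>2 + (real_of_int k)\<^sup>2)"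
    using k c by (intro *) auto
  moreover have "1.06902 * p \<le> sqrt ((real_of_int c - a)\<^sup>2 + (real_of_int k + 1)\<^sup>2)"
    using k c a p by (intro *) auto
  moreover have "(real_of_int a - c)\<^sup>2 = (real_of_int c - a)\<^sup>2"
    "(- real_of_int k - 1)\<^sup>2 = (real_of_int k + 1)\<^sup>2"
    by (simp_all add: power2_eq_square algebra_simps)
  ultimately show ?thesis
    using assms(6) unfolding hex_vectors_def norm_lat by auto
qed

text \<open>Two points of the cell that differ by a vector \<open>w\<close> of \<open>W\<close> would be separated by the
  bisector strip of \<open>w\<close>.\<close>

lemma diff_cell_notin:
  assumes "y \<in> cell R W" "z \<in> cell R W" "y - z \<in> W" "z - y \<in> W"
  shows False
proof -
  have "2 * (lat y \<bullet> lat (y - z)) < (norm (lat (y - z)))\<^sup>2"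
    "2 * (lat z \<bullet> lat (z - y)) < (norm (lat (z - y)))\<^sup>2"
    using assms by (auto simp: cell_def)
  moreover have "(norm (lat (z - y)))\<^sup>2 = (norm (lat (y - z)))\<^sup>2"
    by (simp add: lat_diff norm_minus_commute)
  ultimately have "2 * (lat y \<bullet> lat (y - z)) + 2 * (lat z \<bullet> lat (z - y)) < 2 * (norm (lat (y - z)))\<^sup>2"
    by linarith
  also have "\<dots> = 2 * (lat y \<bullet> lat (y - z)) + 2 * (lat z \<bullet> lat (z - y))"
    unfolding power2_norm_eq_inner by (simp add: lat_diff inner_diff inner_commute)
  finally show False by simp
qed

section \<open>Dots from a window\<close>

text \<open>The dots are the points of \<open>S\<close> that \<open>\<phi>\<close> sends into a
  suitable translate of Ruzsa's set. Injectivity modulo \<open>N\<close> makes the image of a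
  nonzero difference nonzero, as the Sidon property requires; averaging gives at least (p - 1) |S| /
  N = |S| / p dots.\<close>

lemma exists_DD_of_window:
  fixes S :: "(int \<times> int) set" and p :: nat and a :: int
  assumes "prime p" "p > 2" "finite S"
    and inj: "\<And>y z. y \<in> S \<Longrightarrow> z \<in> S \<Longrightarrow>
      int p * (int p - 1) dvd fst (y - z) + a * snd (y - z) \<Longrightarrow> y = z"
    and diam: "\<And>y z. y \<in> S \<Longrightarrow> z \<in> S \<Longrightarrow> norm (lat (y - z)) \<le> r"
  shows "\<exists>m D. is_DD m r D \<and> real m * real p \<ge> real (card S)"
proof -
  have "odd p" using assms(1,2) by (simp add: prime_odd_nat)
  then obtain g where "\<forall>k>0. residue_primroot (p ^ k) g"
    using residue_primroot_odd_prime_power_exists[OF assms(1)] by blast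
  hence g: "residue_primroot p g" by (metis power_one_right zero_less_one)
  interpret primitive_root p g by unfold_locales (use assms(1,2) g in auto)
  define N where "N = int p * (int p - 1)"
  define \<phi> :: "int \<times> int \<Rightarrow> int" where "\<phi> z = fst z + a * snd z" for z
  have N: "N > 0" using assms(2) by (simp add: N_def)
  have "int (card {t \<in> {0..<N}. ruzsa p g (c + t)}) \<ge> int p - 1" for c
    using card_ruzsa_ge[of c] unfolding N_def by linarith
  then obtain t where t: "N * int (card {s \<in> S. ruzsa p g (\<phi> s + t)}) \<ge> (int p - 1) * int (card S)"
    using exists_shift_card_ge[OF assms(3) N, of "int p - 1" "ruzsa p g" \<phi>] by blast
  define E where "E = {s \<in> S. ruzsa p g (\<phi> s + t)}"
  define emb :: "int \<times> int \<Rightarrow> real \<times> real" where "emb = map_prod of_int of_int"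
  have emb_inj: "inj emb" unfolding emb_def by (intro prod.inj_map) (auto simp: inj_def)
  have emb_diff: "emb y - emb z = emb (y - z)" for y z by (cases y; cases z) (simp add: emb_def)
  have emb_norm: "norm (emb z) = norm (lat z)" for z
    by (cases z) (simp add: emb_def norm_lat norm_prod_def)
  have phi_diff: "\<phi> y - \<phi> z = \<phi> (y - z)" for y z by (simp add: \<phi>_def algebra_simps)
  have E: "finite E" "E \<subseteq> S" using assms(3) by (auto simp: E_def)
  have uniq: "y1 = y2 \<and> z1 = z2"
    if "y1 \<in> E" "z1 \<in> E" "y2 \<in> E" "z2 \<in> E" "y1 \<noteq> z1" "y1 - z1 = y2 - z2" for y1 z1 y2 z2
  proof -
    define d where "d = \<phi> (y1 - z1)"
    have y1: "\<phi> y1 + t = (\<phi> z1 + t) + d" using phi_diff[of y1 z1] by (simp add: d_def)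
    have y2: "\<phi> y2 + t = (\<phi> z2 + t) + d" using phi_diff[of y2 z2] that(6) by (simp add: d_def)
    have "\<not> [d = 0] (mod N)"
      using inj[of y1 z1] that E by (auto simp: d_def \<phi>_def N_def cong_0_iff)
    hence "[\<phi> z1 + t = \<phi> z2 + t] (mod N)"
      using that y1 y2 unfolding N_def by (intro ruzsa_sidon[of _ d]) (auto simp: E_def)
    hence "N dvd \<phi> (z1 - z2)" by (simp add: cong_iff_dvd_diff phi_diff)
    hence "z1 = z2" using inj[of z1 z2] that E by (auto simp: \<phi>_def N_def)
    thus ?thesis using that(6) by (metis diff_add_cancel)
  qed
  have "is_DD (card E) r (emb ` E)"
    unfolding is_DD_def
  proof (intro conjI ballI)
    show "emb ` E \<subseteq> \<int> \<times> \<int>" by (auto simp: emb_def)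
    show "finite (emb ` E)" using E by auto
    show "card (emb ` E) = card E" using emb_inj by (intro card_image) (auto simp: inj_on_def)
    fix x y assume "x \<in> emb ` E" "y \<in> emb ` E"
    then obtain x' y' where xy: "x = emb x'" "y = emb y'" "x' \<in> S" "y' \<in> S" using E by blast
    show "dist x y \<le> r" using diam[OF xy(3,4)] by (simp only: xy(1,2) dist_norm emb_diff emb_norm)
  next
    show "inj_on (\<lambda>(a, b). a - b) {(a, b). a \<in> emb ` E \<and> b \<in> emb ` E \<and> a \<noteq> b}"
    proof (rule inj_onI)
      fix u v
      assume uv: "u \<in> {(a, b). a \<in> emb ` E \<and> b \<in> emb ` E \<and> a \<noteq> b}"
        "v \<in> {(a, b). a \<in> emb ` E \<and> b \<in> emb ` E \<and> a \<noteq> b}"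
        "(case u of (a, b) \<Rightarrow> a - b) = (case v of (a, b) \<Rightarrow> a - b)"
      obtain y1 z1 where u: "u = (emb y1, emb z1)" "y1 \<in> E" "z1 \<in> E" "y1 \<noteq> z1"
        using uv(1) by blast
      obtain y2 z2 where v: "v = (emb y2, emb z2)" "y2 \<in> E" "z2 \<in> E"
        using uv(2) by blast
      have "emb (y1 - z1) = emb (y2 - z2)" using uv(3) by (simp add: u(1) v(1) emb_diff)
      hence "y1 - z1 = y2 - z2" using emb_inj by (simp add: inj_eq)
      hence "y1 = y2 \<and> z1 = z2" using u(2-4) v(2,3) by (intro uniq)
      thus "u = v" by (simp add: u(1) v(1))
    qed
  qed
  moreover have "real (card E) * p \<ge> card S"
  proof -
    have "(int p - 1) * int (card S) \<le> (int p - 1) * (int p * int (card E))"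
      using t by (simp add: N_def E_def mult_ac)
    hence "int (card S) \<le> int p * int (card E)" using assms(2) by (subst (asm) mult_le_cancel_left_pos) auto
    hence "card S \<le> card E * p" by (simp flip: of_nat_mult add: mult.commute)
    thus ?thesis by (metis of_nat_le_iff of_nat_mult)
  qed
  ultimately show ?thesis by blast
qed

text \<open>
  Here \<open>e \<le> (1 - 0.5345 * 1.65) R = 0.118075 R\<close>, and bounding \<open>sqrt e\<close> by this extreme value
  replaces the area of the caps by a linear function of \<open>e\<close>.
\<close>

lemma area_bound:
  fixes p R :: real
  assumes R: "R \<ge> 2000" and p: "1.65 * R \<le> p" "p \<le> 1.934 * R"
  defines "e \<equiv> max 0 (R - 0.5345 * p)"
  shows "pi * (R - 1)\<^sup>2 - 6 * (4 * sqrt 2 / 3 * sqrt R * (e * sqrt e)) \<ge> 1.62 * p * R"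
proof -
  have "e \<le> 0.118075 * R"
    unfolding e_def by (rule max.boundedI) (use R p in auto)
  hence e: "0 \<le> e" "e \<le> 0.118075 * R" by (auto simp: e_def)
  have sqrt_Re: "sqrt R * sqrt e \<le> 0.34363 * R"
  proof -
    have "R * e \<le> R * (0.118075 * R)" using e R by (intro mult_left_mono) auto
    also have "\<dots> \<le> (0.34363 * R)\<^sup>2" by (simp add: power2_eq_square)
    finally have "sqrt (R * e) \<le> 0.34363 * R" using R by (intro real_le_lsqrt) auto
    thus ?thesis by (simp add: real_sqrt_mult)
  qed
  have "sqrt 2 \<le> (1.414214 :: real)" by (intro real_le_lsqrt) (auto simp: power2_eq_square)
  hence "8 * sqrt 2 \<le> (8 * 1.414214 :: real)" by simp
  from mult_right_mono[OF mult_mono[OF this sqrt_Re] e(1)]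
  have "8 * sqrt 2 * (sqrt R * sqrt e) * e \<le> 8 * 1.414214 * (0.34363 * R) * e"
    using e R by simp
  also have "\<dots> \<le> 3.888 * R * e" using e R by (intro mult_right_mono) auto
  finally have cap: "6 * (4 * sqrt 2 / 3 * sqrt R * (e * sqrt e)) \<le> 3.888 * R * e"
    by (simp add: mult_ac)
  \<comment> \<open>For \<open>e > 0\<close> the left side decreases in \<open>p\<close>, so p =
    1.65 R is worst; otherwise it increases, so p = 1.934 R is worst. Both values stay below 3.1347
    R^2, and the gap to pi pays for replacing \<open>R\<close> by \<open>R - 1\<close>.\<close>
  have "3.888 * R * e + 1.62 * p * R \<le> 3.1327 * R\<^sup>2 + 0.002 * R\<^sup>2"
  proof (cases "R - 0.5345 * p \<ge> 0")
    case True
    have "3.888 * R * e + 1.62 * p * R = R * (3.888 * R - 0.458136 * p)"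
      using True by (simp add: e_def algebra_simps)
    also have "\<dots> \<le> R * (3.1347 * R)" using R p by (intro mult_left_mono) auto
    finally show ?thesis by (simp add: power2_eq_square)
  next
    case False
    have "3.888 * R * e + 1.62 * p * R = R * (1.62 * p)" using False by (simp add: e_def)
    also have "\<dots> \<le> R * (3.1347 * R)" using R p by (intro mult_left_mono) auto
    finally show ?thesis by (simp add: power2_eq_square)
  qed
  also have "\<dots> \<le> pi * (R - 1)\<^sup>2"
  proof -
    have "3.1347 * R\<^sup>2 \<le> 3.1415 * (R - 1)\<^sup>2"
    proof -
      have "R * (0.0068 * R - 6.283) \<ge> 0" using R by (intro mult_nonneg_nonneg) auto
      thus ?thesis by (simp add: power2_eq_square algebra_simps)
    qed
    also have "\<dots> \<le> pi * (R - 1)\<^sup>2" using pi_approx by (intro mult_right_mono) auto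
    finally show ?thesis by (simp add: algebra_simps)
  qed
  finally show ?thesis using cap by simp
qed

section \<open>Choice of the prime and conclusion\<close>

lemma eventually_exists_DD:
  "eventually (\<lambda>r :: nat. \<exists>m D. is_DD m (real r) D \<and> real m \<ge> 0.81 * real r) sequentially"
proof -
  have lim: "filterlim (\<lambda>r :: nat. 1.65 * (real r / 2)) at_top sequentially" by real_asymp
  obtain p0 where p0: "\<And>p :: nat. p \<ge> p0 \<Longrightarrow> \<exists>a k c :: int. int p * (int p - 1) = a * k + c \<and>
     1.06902 * p \<le> a \<and> a \<le> 1.0691 * p \<and> 0.9353 * p \<le> k  \<and>
     0.5344 * p \<le> c \<and> c \<le> 0.5347 * p"
    using eventually_hex_lattice_basis unfolding eventually_sequentially by blast
  \<comment> \<open>1.172 exceeds 90/77, while 1.172 * 1.65 = 1.9338 stays below 1.934.\<close>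
  have "eventually (\<lambda>r :: nat. \<exists>p. prime p \<and> 1.65 * (real r / 2) < real p \<and>
           real p \<le> 1.172 * (1.65 * (real r / 2))) sequentially"
    using eventually_compose_filterlim[OF eventually_prime_between[of "1.172"] lim] by simp
  \<comment> \<open>This yields p \<ge> 100000, so that 1.06902 p / 2 - 1 \<ge> 0.5345 p, the cap
    height used below.\<close>
  moreover have "eventually (\<lambda>r :: nat. r \<ge> 200000 \<and> r \<ge> 2 * p0) sequentially"
    by (intro eventually_conj eventually_ge_at_top)
  ultimately show ?thesis
  proof eventually_elim
    case (elim r)
    define R where "R = real r / 2"
    obtain p where p: "prime p" "1.65 * R < real p" "real p \<le> 1.172 * (1.65 * R)"
      using elim by (auto simp: R_def)
    have R: "R \<ge> 100000" "R \<ge> p0" using elim by (auto simp: R_def)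
    have "real p \<ge> 100000" "real p \<ge> real p0" "real p \<le> 1.934 * R" using p R by simp_all
    hence pR: "real p \<ge> 100000" "p \<ge> p0" "p > 2" "real p \<le> 1.934 * R" by simp_all
    obtain a k c :: int where akc: "int p * (int p - 1) = a * k + c"
      "1.06902 * p \<le> a" "a \<le> 1.0691 * p" "0.9353 * p \<le> k"
      "0.5344 * p \<le> c" "c \<le> 0.5347 * p"
      using p0[OF pR(2)] by blast
    define W where "W = hex_vectors a k c"
    define S where "S = cell R W"
    have diam: "norm (lat (y - z)) \<le> r" if "y \<in> S" "z \<in> S" for y z
      using that norm_triangle_ineq4[of "lat y" "lat z"]
      by (simp add: S_def cell_def lat_diff R_def)
    have inW: "d \<in> W" if "norm (lat d) \<le> r" "d \<noteq> 0"
      "int p * (int p - 1) dvd fst d + a * snd d" for d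
    proof -
      have "(fst d, snd d) \<in> hex_vectors a k c"
      proof (rule short_lattice_vectors)
        show "real_of_int (int p * (int p - 1)) = real p * (real p - 1)" by simp
        show "\<bar>real_of_int (fst d)\<bar> \<le> real r" "\<bar>real_of_int (snd d)\<bar> \<le> real r"
          using that(1) component_le_norm_cart[of "lat d" 1] component_le_norm_cart[of "lat d" 2]
          by simp_all
        \<comment> \<open>From r = 2 R and p > 1.65 R, where 2 / 1.65 = 1.21212...\<close>
        show "real r \<le> 1.2122 * real p" using p by (simp add: R_def)
      qed (use akc pR that in auto)
      thus ?thesis by (simp add: W_def)
    qed
    have "\<exists>m D. is_DD m r D \<and> real m * real p \<ge> real (card S)"
    proof (rule exists_DD_of_window[OF p(1) pR(3), where a = a])
      show "finite S" unfolding S_def by (rule finite_cell)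
      show "norm (lat (y - z)) \<le> r" if "y \<in> S" "z \<in> S" for y z using that by (rule diam)
      fix y z assume yz: "y \<in> S" "z \<in> S" "int p * (int p - 1) dvd fst (y - z) + a * snd (y - z)"
      show "y = z"
      proof (rule ccontr)
        assume "y \<noteq> z"
        have "int p * (int p - 1) dvd - (fst (y - z) + a * snd (y - z))" using yz(3) by (simp only: dvd_minus_iff)
        hence "int p * (int p - 1) dvd fst (z - y) + a * snd (z - y)" by (simp add: algebra_simps)
        hence "z - y \<in> W" "y - z \<in> W" using yz \<open>y \<noteq> z\<close> by (auto intro!: inW diam)
        thus False using diff_cell_notin yz unfolding S_def by blast
      qed
    qed
    then obtain m D where mD: "is_DD m r D" "real m * real p \<ge> real (card S)" by blast
    have "card W \<le> 6" unfolding W_def hex_vectors_def by (intro card_insert_le_m1) auto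
    define M where "M = 4 * sqrt 2 / 3 * sqrt R * (max 0 (R - 0.5345 * p) * sqrt (max 0 (R - 0.5345 * p)))"
    have M: "M \<ge> 0" using R by (auto simp: M_def)
    have "1.62 * p * R \<le> pi * (R - 1)\<^sup>2 - 6 * M"
      unfolding M_def using p pR R by (intro area_bound) auto
    also have "\<dots> \<le> pi * (R - 1)\<^sup>2 - card W * M"
      using \<open>card W \<le> 6\<close> M by (intro diff_mono mult_right_mono) auto
    also have "\<dots> \<le> card S"
      unfolding M_def S_def
    proof (rule card_cell_ge)
      show "finite W" by (simp add: W_def hex_vectors_def)
      fix w assume "w \<in> W"
      hence "1.06902 * p \<le> norm (lat w)"
        using akc unfolding W_def by (intro norm_hex_vectors_ge[of p a k c w]) auto
      thus "0.5345 * p \<le> norm (lat w) / 2 - 1" using pR(1) by simp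
    qed (use R pR in auto)
    finally have "(1.62 * R) * p \<le> real m * p" using mD by (simp add: mult_ac)
    hence "1.62 * R \<le> m" using pR by (subst (asm) mult_le_cancel_right_pos) auto
    thus ?case using mD by (auto simp: R_def)
  qed
qed

theorem theorem19:
  shows "\<exists>g :: nat \<Rightarrow> real.
           ((\<lambda>r. g r / real r) \<longlonglongrightarrow> 0) \<and>
           (\<forall>r :: nat. r > 0 \<longrightarrow>
              (\<exists>m D. is_DD m (real r) D \<and> real m \<ge> (mu / 2) * real r - g r))"
proof -
  obtain r0 where r0: "\<And>r. r \<ge> r0 \<Longrightarrow> \<exists>m D. is_DD m (real r) D \<and> real m \<ge> 0.81 * real r"
    using eventually_exists_DD unfolding eventually_sequentially by blast
  \<comment> \<open>Below \<open>r0\<close> the error term swallows the whole main term, so the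
    empty set suffices there; beyond \<open>r0\<close> it vanishes.\<close>
  define g where "g r = (if r \<ge> r0 then 0 else mu / 2 * real r)" for r :: nat
  have "eventually (\<lambda>r. g r / real r = 0) sequentially"
    using eventually_ge_at_top[of r0] by eventually_elim (simp add: g_def)
  hence "(\<lambda>r. g r / real r) \<longlonglongrightarrow> 0" by (rule tendsto_eventually)
  moreover have "\<exists>m D. is_DD m (real r) D \<and> real m \<ge> (mu / 2) * real r - g r" for r
  proof (cases "r \<ge> r0")
    case True
    have "mu / 2 * real r \<le> 0.81 * real r" using mu_le by (intro mult_right_mono) auto
    thus ?thesis using r0[OF True] True by (force simp: g_def)
  next
    case False
    have "is_DD 0 (real r) {}" by (simp add: is_DD_def)
    thus ?thesis using False by (force simp: g_def)
  qed
  ultimately show ?thesis by blast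
qed

end
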